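(* Let $\Gamma$ be a finite mixed graph with vertex set $V$, let $G_\Gamma$ be the twisted right-angled Artin group based on $\Gamma$, and let $\mathcal{R}_0$ be the rewriting system over $S=V\cup V^{-1}$ associated with $\Gamma$ and a fixed total order of $S$ (see context). The Knuth–Bendix algorithm of completion of $\mathcal{R}_0$ yields an equivalent complete rewriting system $\mathcal{R}$ satisfying these conditions: (i) All the rules in $\mathcal{R}$ (other than the vertex rewrite-rules $z^{\gamma}z^{-\gamma}\to 1$) appear as $\langle u,x\rangle\to\langle x,u\rangle$ with $u=\langle v_1v_2\cdots v_{k-1}v_k\rangle$ and $x,v_i\in V\cup V^{-1}$ for all $1\le i\le k$ (here $v_1,\dots,v_k$ denote arbitrary letters), and they satisfy the prefix condition. (ii) New rules are created only from overlaps between rules from $\mathcal{R}$ at left and rules from $\mathcal{R}_0$ at right; all the other kinds of overlaps resolve (including overlaps between rules from $\mathcal{R}_0$ at left and rules from $\mathcal{R}\setminus\mathcal{R}_0$ at right). (iii) The rules created in the $n$-th step of completion have words of length $n+2$ on each side.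
   Context: A mixed graph $\Gamma$ consists of a vertex set $V$ (here finite), a set $E$ of two-element subsets of $V$ (edges), and a subset $D\subseteq E$ of directed edges, each $e\in D$ having an origin $o(e)$ and a terminus $t(e)$ with $e=\{o(e),t(e)\}$, $o(e)\ne t(e)$. An undirected edge $\{a,b\}$ is written $[a,b]$; a directed edge with origin $a$ and terminus $b$ is written $[a,b\rangle$. The twisted right-angled Artin group based on $\Gamma$ is $G_\Gamma=\langle V\mid ab=ba \text{ if }[a,b]\text{ is an undirected edge},\ aba=b\text{ if }[a,b\rangle\text{ is a directed edge}\rangle$. Rewriting systems: a rewriting system on the free monoid $S^*$ is a set of rules $(l,r)\in S^*\times S^*$, written $l\to r$; one writes $plq\to prq$ for a one-step reduction and $\to^*$ for the reflexive transitive closure. It is Noetherian if there is no infinite chain of one-step reductions, confluent if $u\to^*w_1$ and $u\to^*w_2$ imply that $w_1,w_2$ have a common descendant under $\to^*$, and complete if it is both. Two systems are equivalent if they generate the same equivalence relation $\leftrightarrow^*$ on $S^*$. Order $S=V\cup V^{-1}$ by $v_1<v_1^{-1}<\dots<v_n<v_n^{-1}$, where $V=\{v_1,\dots,v_n\}$, and order $S^*$ by the induced shortlex order. The system $\mathcal{R}_0$ consists, for $x,y,z\in V$ with $x<y$ and $\alpha,\beta,\gamma\in\{-1,1\}$, of the edge rewrite-rules $y^\beta x^\alpha\to x^\alpha y^\beta$ if $[x,y]$ is an undirected edge; $y^\beta x^\alpha\to x^{-\alpha}y^\beta$ if $[x,y\rangle$ is a directed edge; $y^\beta x^\alpha\to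 x^\alpha y^{-\beta}$ if $[y,x\rangle$ is a directed edge; and of the vertex rewrite-rules $z^\gamma z^{-\gamma}\to 1$. Notation: for a word $w=g_1\cdots g_k$ with $g_i\in\{v_i,v_i^{-1}\}$ (the $v_i$ arbitrary vertices), $\langle w\rangle=\{v_1^{\alpha_1}\cdots v_k^{\alpha_k}\mid \alpha_i\in\{-1,1\}\}$. The notation $\langle u,x\rangle\to\langle x,u\rangle$ records the positions of letters and not their signs: for vertices $g_1,\dots,g_k,x$ with every $g_i$ adjacent to $x$, $\langle g_1\cdots g_k,x\rangle\to\langle x,g_1\cdots g_k\rangle$ embodies the rules $g_1^{j_1}\cdots g_k^{j_k}x^{\epsilon}\to x^{\epsilon'}g_1^{j_1'}\cdots g_k^{j_k'}$, one for each tuple $(j_1,\dots,j_k,\epsilon)$ with entries in $\{-1,1\}$, where $\epsilon'=(-1)^l\epsilon$ with $l$ the number of indices $i$ such that $[x,g_i\rangle$ is a directed edge, and $j_i'=-j_i$ if $[g_i,x\rangle$ is a directed edge, $j_i'=j_i$ otherwise. The same notation is used when the letters are given as elements of $V\cup V^{-1}$ (only the underlying vertices matter). Prefix condition: rules $\langle u,x\rangle\to\langle x,u\rangle$ with $u=g_1g_2\cdots g_k$, $x,g_i\in V\cup V^{-1}$, satisfy the prefix condition if the rules $\langle g_1,x\rangle\to\langle x,g_1\rangle$ and $\langle x,g_i\rangle\to\langle g_i,x\rangle$ for all $2\le i\le k$ appear in $\mathcal{R}_0$. Knuth–Bendix completion: this is the procedure of examining critical pairs of rules and adjoining new rules when necessary.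 An overlap between a rule $l_1\to r_1$ at left and a rule $l_2\to r_2$ at right is a factorization $l_1=us$, $l_2=sv$ with $s$ non-empty; it gives the two words $r_1v$ and $ur_2$, and it resolves if there is a word $w$ with $r_1v\to^*w$ and $ur_2\to^*w$. If it does not resolve, one obtains two distinct irreducible words, and the rule whose left side is the larger and whose right side is the smaller of them in shortlex order is adjoined. Starting from $\mathcal{R}_0$ (step $0$), $\mathcal{R}_n$ denotes the rewriting system obtained at the $n$-th step of the algorithm, where new rules come from critical pairs between rules already obtained in previous steps; at each step the words in critical pairs are reduced to their normal forms modulo the rewriting system at the earlier step, so that only overlap critical pairs have to be considered. The (possibly infinite) system produced by the procedure is $\mathcal{R}$.
   Formalization: Each completion step treats only the unresolved overlaps on shortest words (treating all at once makes (i)-(iii) false), and a family ⟨u,x⟩→⟨x,u⟩ is claimed to lie in R only for sign tuples whose left side is irreducible under the vertex rules. *)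

theory Defs
  imports Main
begin

section \<open>Mixed graphs\<close>

record 'a mixed_graph =
  verts :: "'a set"
  edges :: "'a set set"
  dir_edges :: "'a set set"
  origin :: "'a set \<Rightarrow> 'a"
  terminus :: "'a set \<Rightarrow> 'a"

definition finite_mixed_graph :: "'a mixed_graph \<Rightarrow> bool" where
  "finite_mixed_graph \<Gamma> \<longleftrightarrow>
     finite (verts \<Gamma>) \<and>
     (\<forall>e\<in>edges \<Gamma>. e \<subseteq> verts \<Gamma> \<and> card e = 2) \<and>
     dir_edges \<Gamma> \<subseteq> edges \<Gamma> \<and>
     (\<forall>e\<in>dir_edges \<Gamma>. e = {origin \<Gamma> e, terminus \<Gamma> e} \<and> origin \<Gamma> e \<noteq> terminus \<Gamma> e)"

definition adjacent :: "'a mixed_graph \<Rightarrow> 'a \<Rightarrow> 'a \<Rightarrow> bool" where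
  "adjacent \<Gamma> a b \<longleftrightarrow> {a, b} \<in> edges \<Gamma>"

definition undirected :: "'a mixed_graph \<Rightarrow> 'a \<Rightarrow> 'a \<Rightarrow> bool" where
  "undirected \<Gamma> a b \<longleftrightarrow> {a, b} \<in> edges \<Gamma> - dir_edges \<Gamma>"

definition directed :: "'a mixed_graph \<Rightarrow> 'a \<Rightarrow> 'a \<Rightarrow> bool" where
  "directed \<Gamma> a b \<longleftrightarrow>
     {a, b} \<in> dir_edges \<Gamma> \<and> origin \<Gamma> {a, b} = a \<and> terminus \<Gamma> {a, b} = b"


section \<open>String rewriting over an alphabet\<close>

type_synonym 'b rule = "'b list \<times> 'b list"

text \<open>A rewriting system on the free monoid over \<open>S\<close> is a set of rules with both
  sides in \<open>lists S\<close>.\<close>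

definition rstep :: "'b set \<Rightarrow> 'b rule set \<Rightarrow> ('b list \<times> 'b list) set" where
  "rstep S R = {(p @ l @ q, p @ r @ q) | p l r q. p \<in> lists S \<and> q \<in> lists S \<and> (l, r) \<in> R}"

definition noetherian :: "'b set \<Rightarrow> 'b rule set \<Rightarrow> bool" where
  "noetherian S R \<longleftrightarrow> \<not> (\<exists>f :: nat \<Rightarrow> 'b list. \<forall>i. (f i, f (Suc i)) \<in> rstep S R)"

definition confluent :: "'b set \<Rightarrow> 'b rule set \<Rightarrow> bool" where
  "confluent S R \<longleftrightarrow>
     (\<forall>u\<in>lists S. \<forall>w1 w2. (u, w1) \<in> (rstep S R)\<^sup>* \<and> (u, w2) \<in> (rstep S R)\<^sup>* \<longrightarrow>
        (\<exists>w. (w1, w) \<in> (rstep S R)\<^sup>* \<and> (w2, w) \<in> (rstep S R)\<^sup>*))"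

definition complete_system :: "'b set \<Rightarrow> 'b rule set \<Rightarrow> bool" where
  "complete_system S R \<longleftrightarrow> noetherian S R \<and> confluent S R"

definition equivalent_systems :: "'b set \<Rightarrow> 'b rule set \<Rightarrow> 'b rule set \<Rightarrow> bool" where
  "equivalent_systems S R R' \<longleftrightarrow>
     (rstep S R \<union> (rstep S R)\<inverse>)\<^sup>* = (rstep S R' \<union> (rstep S R')\<inverse>)\<^sup>*"

definition irreducible_word :: "'b set \<Rightarrow> 'b rule set \<Rightarrow> 'b list \<Rightarrow> bool" where
  "irreducible_word S R w \<longleftrightarrow> \<not> (\<exists>w'. (w, w') \<in> rstep S R)"

definition normal_form_of :: "'b set \<Rightarrow> 'b rule set \<Rightarrow> 'b list \<Rightarrow> 'b list \<Rightarrow> bool" where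
  "normal_form_of S R w a \<longleftrightarrow> (w, a) \<in> (rstep S R)\<^sup>* \<and> irreducible_word S R a"


section \<open>Knuth--Bendix completion\<close>

datatype 'b overlap =
  Overlap (left_rule: "'b rule") (right_rule: "'b rule")
    (left_part: "'b list") (shared: "'b list") (right_part: "'b list")

definition overlaps :: "'b rule set \<Rightarrow> 'b overlap set" where
  "overlaps R = {Overlap (u @ s, r1) (s @ v, r2) u s v | u s v r1 r2.
     s \<noteq> [] \<and> (u @ s, r1) \<in> R \<and> (s @ v, r2) \<in> R}"

definition overlap_word :: "'b overlap \<Rightarrow> 'b list" where
  "overlap_word ov = left_part ov @ shared ov @ right_part ov"

definition reduct_left :: "'b overlap \<Rightarrow> 'b list" where
  "reduct_left ov = snd (left_rule ov) @ right_part ov"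

definition reduct_right :: "'b overlap \<Rightarrow> 'b list" where
  "reduct_right ov = left_part ov @ snd (right_rule ov)"

definition resolves :: "'b set \<Rightarrow> 'b rule set \<Rightarrow> 'b overlap \<Rightarrow> bool" where
  "resolves S R ov \<longleftrightarrow>
     (\<exists>w. (reduct_left ov, w) \<in> (rstep S R)\<^sup>* \<and> (reduct_right ov, w) \<in> (rstep S R)\<^sup>*)"

definition unresolved :: "'b set \<Rightarrow> 'b rule set \<Rightarrow> 'b overlap set" where
  "unresolved S R = {ov \<in> overlaps R. \<not> resolves S R ov}"

text \<open>Critical pairs are examined shortest overlap word first: the overlaps treated in a step are
  the shortest unresolved ones. Treating every unresolved overlap between the rules obtained so
  far at once would create superfluous rules. For example, let \<open>b < a < c < x < y\<close> be vertices
  with undirected edges \<open>[y,x]\<close>, \<open>[a,x]\<close>, \<open>[c,x]\<close> and \<open>[b,c]\<close>. The rules \<open>yax \<rightarrow> xya\<close> and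
  \<open>xbc \<rightarrow> cxb\<close> of the first step overlap in \<open>yaxbc\<close>, which gives the words \<open>xyabc\<close> and \<open>yacxb\<close>.
  These have no common descendant until \<open>yacx \<rightarrow> xyac\<close> has been added in the second step.\<close>

definition treated :: "'b set \<Rightarrow> 'b rule set \<Rightarrow> 'b overlap set" where
  "treated S R = {ov \<in> unresolved S R.
     \<forall>ov'\<in>unresolved S R. length (overlap_word ov) \<le> length (overlap_word ov')}"

text \<open>\<open>ord\<close> is the strict order on words, \<open>(a, b) \<in> ord\<close> meaning that \<open>a\<close> is smaller than \<open>b\<close>.\<close>

definition created_rule ::
    "'b set \<Rightarrow> ('b list \<times> 'b list) set \<Rightarrow> 'b rule set \<Rightarrow> 'b overlap \<Rightarrow> 'b rule \<Rightarrow> bool" where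
  "created_rule S ord R ov \<rho> \<longleftrightarrow>
     (\<exists>a b. normal_form_of S R (reduct_left ov) a \<and> normal_form_of S R (reduct_right ov) b \<and>
        (\<rho> = (a, b) \<and> (b, a) \<in> ord \<or> \<rho> = (b, a) \<and> (a, b) \<in> ord))"

text \<open>As \<open>R\<close> need not be confluent, a word can have several normal forms modulo \<open>R\<close>; \<open>c\<close> chooses
  the rule that is created from each treated overlap.\<close>

definition kb_step ::
    "'b set \<Rightarrow> ('b list \<times> 'b list) set \<Rightarrow> 'b rule set \<Rightarrow> 'b rule set \<Rightarrow> bool" where
  "kb_step S ord R R' \<longleftrightarrow>
     (\<exists>c. (\<forall>ov\<in>treated S R. created_rule S ord R ov (c ov)) \<and> R' = R \<union> c ` treated S R)"

definition kb_completion ::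
    "'b set \<Rightarrow> ('b list \<times> 'b list) set \<Rightarrow> 'b rule set \<Rightarrow> (nat \<Rightarrow> 'b rule set) \<Rightarrow> bool" where
  "kb_completion S ord R0 Rs \<longleftrightarrow> Rs 0 = R0 \<and> (\<forall>n. kb_step S ord (Rs n) (Rs (Suc n)))"


section \<open>The rewriting system of a mixed graph\<close>

text \<open>The letter \<open>(v, False)\<close> stands for the vertex \<open>v\<close> and \<open>(v, True)\<close> for its inverse, so
  changing the sign of an exponent is negation. The enumeration of the vertices is given by the
  linear order on their type.\<close>

type_synonym 'a letter = "'a \<times> bool"

definition letters :: "'a mixed_graph \<Rightarrow> 'a letter set" where
  "letters \<Gamma> = verts \<Gamma> \<times> UNIV"

definition letter_order :: "('a::linorder letter \<times> 'a letter) set" where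
  "letter_order = {((v, s), (w, t)). v < w \<or> v = w \<and> \<not> s \<and> t}"

abbreviation shortlex :: "('a::linorder letter list \<times> 'a letter list) set" where
  "shortlex \<equiv> lenlex letter_order"

definition edge_rules :: "'a::linorder mixed_graph \<Rightarrow> 'a letter rule set" where
  "edge_rules \<Gamma> =
     {([(y, \<beta>), (x, \<alpha>)], [(x, \<alpha>), (y, \<beta>)]) | x y \<alpha> \<beta>. x < y \<and> undirected \<Gamma> x y} \<union>
     {([(y, \<beta>), (x, \<alpha>)], [(x, \<not> \<alpha>), (y, \<beta>)]) | x y \<alpha> \<beta>. x < y \<and> directed \<Gamma> x y} \<union>
     {([(y, \<beta>), (x, \<alpha>)], [(x, \<alpha>), (y, \<not> \<beta>)]) | x y \<alpha> \<beta>. x < y \<and> directed \<Gamma> y x}"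

definition vertex_rules :: "'a mixed_graph \<Rightarrow> 'a letter rule set" where
  "vertex_rules \<Gamma> = {([(z, \<gamma>), (z, \<not> \<gamma>)], []) | z \<gamma>. z \<in> verts \<Gamma>}"

definition initial_system :: "'a::linorder mixed_graph \<Rightarrow> 'a letter rule set" where
  "initial_system \<Gamma> = edge_rules \<Gamma> \<union> vertex_rules \<Gamma>"

text \<open>The rules \<open>\<langle>g\<^sub>1 \<dots> g\<^sub>k, x\<rangle> \<rightarrow> \<langle>x, g\<^sub>1 \<dots> g\<^sub>k\<rangle>\<close>, one for each choice of the signs \<open>js\<close> of the \<open>g\<^sub>i\<close>
  and of the sign \<open>e\<close> of \<open>x\<close>; inequality of booleans is exclusive or. They are meaningful only
  when every \<open>g\<^sub>i\<close> is adjacent to \<open>x\<close>.\<close>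

definition commutation_rules :: "'a mixed_graph \<Rightarrow> 'a list \<Rightarrow> 'a \<Rightarrow> 'a letter rule set" where
  "commutation_rules \<Gamma> gs x =
     {(zip gs js @ [(x, e)],
       (x, e \<noteq> odd (length (filter (directed \<Gamma> x) gs))) #
         map (\<lambda>(g, j). (g, j \<noteq> directed \<Gamma> g x)) (zip gs js)) | js e.
      length js = length gs}"

definition prefix_condition :: "'a::linorder mixed_graph \<Rightarrow> 'a list \<Rightarrow> 'a \<Rightarrow> bool" where
  "prefix_condition \<Gamma> gs x \<longleftrightarrow>
     commutation_rules \<Gamma> [hd gs] x \<subseteq> initial_system \<Gamma> \<and>
     (\<forall>g\<in>set (tl gs). commutation_rules \<Gamma> [x] g \<subseteq> initial_system \<Gamma>)"

end

theory Submission
  imports Defs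
begin

text \<open>The completion can be written down in closed form. Call a word \<^emph>\<open>normal\<close> if it is freely reduced
  and no letter can be moved to the left over a larger letter: there is no factor \<open>b u x\<close> with
  \<open>x < b\<close> and \<open>x\<close> adjacent to all vertices of \<open>b u\<close>. The left sides of the completed system are
  the minimal words that are not normal. Minimality forces them to be \<open>z\<^sup>\<gamma> z\<^sup>-\<^sup>\<gamma>\<close> or
  \<open>g\<^sub>1 \<dots> g\<^sub>k x\<close> with \<open>g\<^sub>1 > x > g\<^sub>i\<close> for \<open>i \<ge> 2\<close>, all \<open>g\<^sub>i\<close> adjacent to \<open>x\<close> and \<open>g\<^sub>1 \<dots> g\<^sub>k\<close> normal;
  this order condition is the prefix condition. So the irreducible words of the completed system are the normal
  ones.

  The main point is that every element of the group has only one normal word (\<open>normal_unique\<close>).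
  For this the twist is removed: when the sign of each letter \<open>y\<close> is changed by the parity of the
  number of letters \<open>g\<close> to its left with \<open>[y, g\<rangle>\<close> a directed edge, the directed rules become plain
  commutations and the cancellations remain cancellations (\<open>foldr_act_rule\<close>). In the untwisted
  case a word is determined up to commutations by its projections to pairs of non-adjacent
  vertices, and left multiplication by a letter can be computed on these projections, where the
  defining relations are easily checked. Hence congruent reduced words have the same
  projections, and normal words with the same projections are equal because at the first
  difference one of them could be lowered by moving a letter to the left. Confluence follows.

  For the steps of the completion, let \<open>T\<^sub>n\<close> be the set of rules of the completed system whose left
  side has length at most \<open>n + 2\<close>. A \<open>T\<^sub>n\<close>-irreducible word of length at most \<open>n + 3\<close> is either normal
  or itself the left side of a rule of length \<open>n + 3\<close>. As right sides are normal and determine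
  their left sides, uniqueness of normal words shows that two congruent words of this kind are
  equal or are the two sides of such a rule (\<open>irreducible_congruent_words\<close>). So overlaps of length
  at most \<open>n + 2\<close> resolve, and those of length \<open>n + 3\<close> resolve or create a rule of
  \<open>T\<^sub>n\<^sub>+\<^sub>1 - T\<^sub>n\<close>, no matter which normal forms are chosen. Conversely \<open>g\<^sub>1 \<dots> g\<^sub>k x\<close> arises from the
  overlap \<open>g\<^sub>1 \<dots> g\<^sub>k\<^sub>-\<^sub>1 x g\<^sub>k\<close>. If no rule of length \<open>n + 3\<close> exists, then \<open>T\<^sub>n\<close> is already the
  completed system, because prefixes of left sides yield left sides. Therefore \<open>T\<^sub>0, T\<^sub>1, \<dots>\<close> is
  the only run of the completion (\<open>kb_completion_iff\<close>). That the right-hand rule of a treated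
  overlap is an initial one follows by comparing the two largest vertices of the overlap word
  with those of the rule that it creates (\<open>treated_right_rule_initial\<close>).\<close>

section \<open>Words over a commutation graph\<close>

definition inv_letter :: "'a letter \<Rightarrow> 'a letter" where
  "inv_letter a = (fst a, \<not> snd a)"

lemma inv_letter_simps [simp]:
  "fst (inv_letter a) = fst a" "inv_letter (inv_letter a) = a" "inv_letter a \<noteq> a" "a \<noteq> inv_letter a"
  by (auto simp: inv_letter_def prod_eq_iff)

definition free_reduced :: "'a letter list \<Rightarrow> bool" where
  "free_reduced w \<longleftrightarrow> \<not> (\<exists>p a q. w = p @ a # inv_letter a # q)"

locale commutation_graph =
  fixes adj :: "'a::linorder \<Rightarrow> 'a \<Rightarrow> bool"
  assumes adj_sym: "adj x y \<Longrightarrow> adj y x"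
    and adj_irrefl: "\<not> adj x x"
begin

text \<open>A word is determined up to exchanging neighbouring letters with adjacent vertices by its
  projections to the letters of \<open>x\<close> and \<open>y\<close>, for all pairs of non-adjacent \<open>x\<close>, \<open>y\<close>, including
  \<open>x = y\<close>. The value for adjacent pairs is fixed to be empty, so that equivalent words have equal
  families of projections.\<close>

definition proj :: "'a letter list \<Rightarrow> 'a \<Rightarrow> 'a \<Rightarrow> 'a letter list" where
  "proj w x y = (if adj x y then [] else filter (\<lambda>l. fst l = x \<or> fst l = y) w)"

text \<open>In terms of words: \<open>a\<^sup>-\<^sup>1\<close> can be brought to the front by commutations; see
  \<open>cancels_proj_iff\<close>.\<close>

definition cancels :: "'a letter \<Rightarrow> ('a \<Rightarrow> 'a \<Rightarrow> 'a letter list) \<Rightarrow> bool" where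
  "cancels a F \<longleftrightarrow> (\<forall>y. \<not> adj (fst a) y \<longrightarrow> (\<exists>t. F (fst a) y = inv_letter a # t))"

text \<open>Left multiplication by \<open>a\<close> on the group elements, which are represented by the projections of
  reduced words.\<close>

definition act :: "'a letter \<Rightarrow> ('a \<Rightarrow> 'a \<Rightarrow> 'a letter list) \<Rightarrow> 'a \<Rightarrow> 'a \<Rightarrow> 'a letter list" where
  "act a F = (\<lambda>x y. if adj x y \<or> fst a \<noteq> x \<and> fst a \<noteq> y then F x y
     else if cancels a F then tl (F x y) else a # F x y)"

text \<open>Words that stay freely reduced under all commutations.\<close>

definition reduced :: "'a letter list \<Rightarrow> bool" where
  "reduced w \<longleftrightarrow>
     \<not> (\<exists>p a m q. w = p @ a # m @ inv_letter a # q \<and> (\<forall>l\<in>set m. adj (fst l) (fst a)))"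

text \<open>Moving \<open>x\<close> to the left over \<open>b u\<close> replaces the word by a smaller one in the shortlex
  order. The letters of \<open>u\<close> are not compared with \<open>x\<close>, so that a factor can witness the failure of
  normality without being minimal.\<close>

definition movable :: "'a list \<Rightarrow> bool" where
  "movable vs \<longleftrightarrow>
     (\<exists>p b u x q. vs = p @ b # u @ x # q \<and> x < b \<and> (\<forall>g\<in>set (b # u). adj g x))"

definition normal :: "'a letter list \<Rightarrow> bool" where
  "normal w \<longleftrightarrow> free_reduced w \<and> \<not> movable (map fst w)"

text \<open>The projection to \<open>{x}\<close> shows that the first letter with the vertex \<open>x\<close> of \<open>a\<close> is \<open>a\<close> itself.
  A letter before it whose vertex \<open>y\<close> is not adjacent to \<open>x\<close> would come before \<open>a\<close> in the
  projection to \<open>{x, y}\<close>.\<close>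

lemma front_of_proj:
  assumes "\<forall>y. \<not> adj (fst a) y \<longrightarrow> (\<exists>t. proj w (fst a) y = a # t)"
  obtains w1 w2 where "w = w1 @ a # w2" "\<forall>l\<in>set w1. adj (fst l) (fst a)"
proof -
  from assms obtain t where "proj w (fst a) (fst a) = a # t"
    using adj_irrefl by blast
  then have "filter (\<lambda>l. fst l = fst a) w = a # t"
    by (simp add: proj_def adj_irrefl)
  then obtain w1 w2 where w: "w = w1 @ a # w2" and no: "\<forall>l\<in>set w1. fst l \<noteq> fst a"
    by (auto simp: filter_eq_Cons_iff)
  have "adj (fst l) (fst a)" if l: "l \<in> set w1" for l
  proof (rule ccontr)
    assume "\<not> adj (fst l) (fst a)"
    then have nadj: "\<not> adj (fst a) (fst l)"
      using adj_sym by blast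
    then obtain t where "proj w (fst a) (fst l) = a # t"
      using assms by blast
    then have eq: "filter (\<lambda>k. fst k = fst a \<or> fst k = fst l) (w1 @ a # w2) = a # t"
      using nadj by (simp add: proj_def w)
    define f where "f = filter (\<lambda>k. fst k = fst a \<or> fst k = fst l) w1"
    have "f \<noteq> []"
      using l by (auto simp: f_def filter_empty_conv)
    moreover have "f @ a # filter (\<lambda>k. fst k = fst a \<or> fst k = fst l) w2 = a # t"
      using eq by (simp add: f_def)
    ultimately have "hd f = a"
      by (cases f) auto
    with \<open>f \<noteq> []\<close> have "a \<in> set f"
      using hd_in_set by metis
    with no show False
      by (auto simp: f_def)
  qed
  with w that show thesis by blast
qed

lemma proj_adjacent_prefix:
  assumes "\<forall>l\<in>set w1. adj (fst l) v" "v = x \<or> v = y"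
  shows "proj (w1 @ w2) x y = proj w2 x y"
proof -
  have "filter (\<lambda>l. fst l = x \<or> fst l = y) w1 = []" if "\<not> adj x y"
    unfolding filter_empty_conv
  proof
    fix l
    assume "l \<in> set w1"
    with assms have "adj (fst l) v" by blast
    moreover have "\<not> adj y x" using that adj_sym by blast
    ultimately show "\<not> (fst l = x \<or> fst l = y)"
      using assms(2) that adj_irrefl by blast
  qed
  then show ?thesis
    by (simp add: proj_def)
qed

lemma proj_move_to_front:
  assumes "\<forall>l\<in>set w1. adj (fst l) (fst a)"
  shows "proj (w1 @ a # w2) = proj (a # w1 @ w2)"
proof (intro ext)
  fix x y
  show "proj (w1 @ a # w2) x y = proj (a # w1 @ w2) x y"
  proof (cases "fst a = x \<or> fst a = y")
    case True
    with proj_adjacent_prefix[OF assms, of x y "a # w2"] proj_adjacent_prefix[OF assms, of x y w2]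
    show ?thesis by (auto simp: proj_def)
  next
    case False
    then show ?thesis by (auto simp: proj_def)
  qed
qed

lemma cancels_proj_iff:
  "cancels a (proj w) \<longleftrightarrow>
     (\<exists>w1 w2. w = w1 @ inv_letter a # w2 \<and> (\<forall>l\<in>set w1. adj (fst l) (fst a)))"
proof
  assume "cancels a (proj w)"
  then show "\<exists>w1 w2. w = w1 @ inv_letter a # w2 \<and> (\<forall>l\<in>set w1. adj (fst l) (fst a))"
    using front_of_proj[of "inv_letter a" w] unfolding cancels_def inv_letter_simps by metis
next
  assume "\<exists>w1 w2. w = w1 @ inv_letter a # w2 \<and> (\<forall>l\<in>set w1. adj (fst l) (fst a))"
  then obtain w1 w2 where w: "w = w1 @ inv_letter a # w2"
    and w1: "\<forall>l\<in>set w1. adj (fst l) (fst (inv_letter a))" by auto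
  show "cancels a (proj w)"
    using proj_move_to_front[OF w1, of w2] by (auto simp: cancels_def w proj_def)
qed

lemma act_delete:
  assumes "\<forall>l\<in>set w1. adj (fst l) (fst a)"
  shows "act a (proj (w1 @ inv_letter a # w2)) = proj (w1 @ w2)"
proof -
  have "cancels a (proj (w1 @ inv_letter a # w2))"
    using assms cancels_proj_iff by blast
  moreover have "proj (w1 @ inv_letter a # w2) = proj (inv_letter a # w1 @ w2)"
    using assms by (intro proj_move_to_front) simp
  ultimately have "act a (proj (w1 @ inv_letter a # w2)) x y = proj (w1 @ w2) x y" for x y
    unfolding act_def by (auto simp: proj_def)
  then show ?thesis by blast
qed

lemma act_Cons: "\<not> cancels a (proj w) \<Longrightarrow> act a (proj w) = proj (a # w)"
  by (auto simp: act_def proj_def fun_eq_iff)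

text \<open>A cancellation in \<open>w1 w2\<close> that is not one in \<open>w1 a w2\<close> would have to cross the place of \<open>a\<close>. But then its
  letter \<open>c\<close> lies in \<open>w1\<close>, so that it commutes with \<open>a\<close>, which thus is no obstacle.\<close>

lemma reduced_delete:
  assumes red: "reduced (w1 @ a # w2)" and w1: "\<forall>l\<in>set w1. adj (fst l) (fst a)"
  shows "reduced (w1 @ w2)"
  unfolding reduced_def
proof (intro notI, elim exE conjE)
  fix p c m q
  assume eq: "w1 @ w2 = p @ c # m @ inv_letter c # q" and m: "\<forall>l\<in>set m. adj (fst l) (fst c)"
  consider s where "w1 = p @ c # m @ inv_letter c # s"
    | s t where "w1 = p @ c # s" "m = s @ t" "w2 = t @ inv_letter c # q"
    | s where "w2 = s @ c # m @ inv_letter c # q"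
  proof -
    from eq consider (a) s where "w1 @ s = p" "w2 = s @ c # m @ inv_letter c # q"
      | (b) s where "w1 = p @ s" "s @ w2 = c # m @ inv_letter c # q"
      unfolding append_eq_append_conv2 by blast
    then show thesis
    proof cases
      case a
      show thesis by (rule that(3)[OF a(2)])
    next
      case b
      show thesis
      proof (cases s)
        case Nil
        with b(2) have "w2 = [] @ c # m @ inv_letter c # q" by simp
        then show thesis by (rule that(3))
      next
        case (Cons d s')
        with b(2) have d: "d = c" and "s' @ w2 = m @ inv_letter c # q" by auto
        then consider (c) t where "s' @ t = m" "w2 = t @ inv_letter c # q"
          | (d) t where "s' = m @ t" "t @ w2 = inv_letter c # q"
          unfolding append_eq_append_conv2 by blast
        then show thesis
        proof cases
          case c
          show thesis
            by (rule that(2)[OF _ c(1)[symmetric] c(2)]) (simp add: b(1) Cons d)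
        next
          case d': d
          show thesis
          proof (cases t)
            case Nil
            with d' have "m = s' @ []" "w2 = [] @ inv_letter c # q" by simp_all
            then show thesis
              by (rule that(2)[rotated]) (simp add: b(1) \<open>s = d # s'\<close> d)
          next
            case (Cons e t')
            with d' have "s' = m @ inv_letter c # t'" by simp
            then show thesis
              by (intro that(1)) (simp add: b(1) \<open>s = d # s'\<close> d)
          qed
        qed
      qed
    qed
  qed
  then show False
  proof cases
    case (1 s)
    then have "w1 @ a # w2 = p @ c # m @ inv_letter c # (s @ a # w2)" by simp
    with red m show False unfolding reduced_def by blast
  next
    case (2 s t)
    then have "w1 @ a # w2 = p @ c # (s @ a # t) @ inv_letter c # q" by simp
    moreover have "\<forall>l\<in>set (s @ a # t). adj (fst l) (fst c)"
      using 2 m w1 adj_sym by auto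
    ultimately show False using red unfolding reduced_def by blast
  next
    case (3 s)
    then have "w1 @ a # w2 = (w1 @ a # s) @ c # m @ inv_letter c # q" by simp
    with red m show False unfolding reduced_def by blast
  qed
qed

lemma reduced_Cons_iff:
  "reduced (a # w) \<longleftrightarrow> reduced w \<and> \<not> cancels a (proj w)"
proof
  assume r: "reduced (a # w)"
  have "reduced w"
    unfolding reduced_def
  proof (intro notI, elim exE conjE)
    fix p c m q
    assume "w = p @ c # m @ inv_letter c # q" and m: "\<forall>l\<in>set m. adj (fst l) (fst c)"
    then have "a # w = (a # p) @ c # m @ inv_letter c # q" by simp
    with r m show False unfolding reduced_def by blast
  qed
  moreover have "\<not> cancels a (proj w)"
    unfolding cancels_proj_iff
  proof (intro notI, elim exE conjE)
    fix m q
    assume "w = m @ inv_letter a # q" and m: "\<forall>l\<in>set m. adj (fst l) (fst a)"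
    then have "a # w = [] @ a # m @ inv_letter a # q" by simp
    with r m show False unfolding reduced_def by blast
  qed
  ultimately show "reduced w \<and> \<not> cancels a (proj w)" ..
next
  assume r: "reduced w \<and> \<not> cancels a (proj w)"
  show "reduced (a # w)"
    unfolding reduced_def
  proof (intro notI, elim exE conjE)
    fix p c m q
    assume eq: "a # w = p @ c # m @ inv_letter c # q" and m: "\<forall>l\<in>set m. adj (fst l) (fst c)"
    show False
    proof (cases p)
      case Nil
      with eq m r show False unfolding cancels_proj_iff by auto
    next
      case (Cons d p')
      with eq have "w = p' @ c # m @ inv_letter c # q" by simp
      with m r show False unfolding reduced_def by blast
    qed
  qed
qed

lemma act_reduced:
  assumes "reduced w"
  obtains w' where "reduced w'" "act a (proj w) = proj w'"
proof (cases "cancels a (proj w)")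
  case True
  then obtain w1 w2 where "w = w1 @ inv_letter a # w2" "\<forall>l\<in>set w1. adj (fst l) (fst a)"
    using cancels_proj_iff by auto
  with assms that[of "w1 @ w2"] show thesis
    using act_delete[of w1 a w2] reduced_delete[of w1 "inv_letter a" w2] by simp
next
  case False
  with assms that[of "a # w"] show thesis
    by (simp add: act_Cons reduced_Cons_iff)
qed

lemma foldr_act_reduced:
  assumes "reduced w"
  obtains w' where "reduced w'" "foldr act u (proj w) = proj w'"
proof -
  have "\<exists>w'. reduced w' \<and> foldr act u (proj w) = proj w'"
  proof (induction u)
    case Nil
    with assms show ?case by (intro exI[of _ w]) simp
  next
    case (Cons a u)
    then obtain w' where "reduced w'" "foldr act u (proj w) = proj w'" by blast
    moreover obtain w'' where "reduced w''" "act a (proj w') = proj w''"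
      using act_reduced[OF \<open>reduced w'\<close>] .
    ultimately show ?case by (intro exI[of _ w'']) simp
  qed
  with that show thesis by blast
qed

text \<open>Reducedness is essential here: it excludes that \<open>a\<close> is deleted from the front and a further
  \<open>a\<^sup>-\<^sup>1\<close> is then deleted instead of \<open>a\<close> being put back.\<close>

lemma act_inverse:
  assumes "reduced w"
  shows "act a (act (inv_letter a) (proj w)) = proj w"
proof (cases "cancels (inv_letter a) (proj w)")
  case True
  then obtain w1 w2 where w: "w = w1 @ a # w2" and w1: "\<forall>l\<in>set w1. adj (fst l) (fst a)"
    using cancels_proj_iff by auto
  have "reduced (a # w1 @ w2)"
  proof (rule ccontr)
    assume "\<not> reduced (a # w1 @ w2)"
    then have "cancels a (proj (w1 @ w2))"
      using assms w w1 reduced_Cons_iff reduced_delete by blast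
    then obtain v1 v2 where eq: "w1 @ w2 = v1 @ inv_letter a # v2"
      and v1: "\<forall>l\<in>set v1. adj (fst l) (fst a)"
      using cancels_proj_iff by blast
    have "inv_letter a \<notin> set w1"
      using w1 adj_irrefl by fastforce
    with eq obtain m where m: "v1 = w1 @ m" "w2 = m @ inv_letter a # v2"
      by (auto simp: append_eq_append_conv2 append_eq_Cons_conv)
    then have "w = w1 @ a # m @ inv_letter a # v2"
      by (simp add: w)
    moreover have "\<forall>l\<in>set m. adj (fst l) (fst a)"
      using v1 m by simp
    ultimately show False using assms unfolding reduced_def by blast
  qed
  then have "act a (proj (w1 @ w2)) = proj (a # w1 @ w2)"
    by (simp add: act_Cons reduced_Cons_iff)
  moreover have "act (inv_letter a) (proj w) = proj (w1 @ w2)"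
    using act_delete[of w1 "inv_letter a" w2] w w1 by simp
  ultimately show ?thesis
    by (simp add: w proj_move_to_front[OF w1])
next
  case False
  then have "act (inv_letter a) (proj w) = proj (inv_letter a # w)"
    by (rule act_Cons)
  moreover have "act a (proj (inv_letter a # w)) = proj w"
    using act_delete[of "[]" a w] by simp
  ultimately show ?thesis by simp
qed

lemma cancels_act:
  assumes "adj (fst a) (fst c)"
  shows "cancels a (act c F) \<longleftrightarrow> cancels a F"
proof -
  have "act c F (fst a) y = F (fst a) y" if "\<not> adj (fst a) y" for y
  proof -
    have "fst c \<noteq> fst a" "fst c \<noteq> y"
      using assms that adj_irrefl by auto
    then show ?thesis by (simp add: act_def)
  qed
  then show ?thesis by (simp add: cancels_def)
qed

text \<open>No pair of non-adjacent vertices contains both vertices, so the two actions change different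
  projections and do not influence each other's test for a cancellation.\<close>

lemma act_commute:
  assumes "adj (fst a) (fst c)"
  shows "act a (act c F) = act c (act a F)"
proof (intro ext)
  fix x y
  have adj': "adj (fst c) (fst a)" and ne: "fst a \<noteq> fst c"
    using assms adj_irrefl adj_sym by (blast, metis)
  show "act a (act c F) x y = act c (act a F) x y"
  proof (cases "fst a = x \<or> fst a = y")
    case True
    then have "adj x y \<or> fst c \<noteq> x \<and> fst c \<noteq> y"
      using assms adj' ne by metis
    then show ?thesis
      unfolding act_def[of a "act c F"] act_def[of c "act a F"] cancels_act[OF assms]
      by (auto simp: act_def)
  next
    case False
    then show ?thesis
      unfolding act_def[of a "act c F"] act_def[of c "act a F"] cancels_act[OF adj']
      by (simp add: act_def)
  qed
qed

lemma foldr_act_of_reduced: "reduced w \<Longrightarrow> foldr act w (proj []) = proj w"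
  by (induction w) (auto simp: reduced_Cons_iff act_Cons)

lemma movable_append: "movable v \<Longrightarrow> movable (u @ v @ w)"
proof -
  assume "movable v"
  then obtain p b s x q where *: "v = p @ b # s @ x # q" "x < b" "\<forall>g\<in>set (b # s). adj g x"
    unfolding movable_def by blast
  then have "u @ v @ w = (u @ p) @ b # s @ x # (q @ w)" by simp
  with * show ?thesis unfolding movable_def by blast
qed

lemma free_reduced_append: "free_reduced (u @ v @ w) \<Longrightarrow> free_reduced v"
  unfolding free_reduced_def by (metis append.assoc append_Cons)

lemma normal_append: "normal (u @ v @ w) \<Longrightarrow> normal v"
  using movable_append free_reduced_append unfolding normal_def by (metis map_append)

text \<open>If \<open>a\<close> could be brought next to its inverse over the letters \<open>m\<close>, then the first letter of \<open>m\<close>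
  could be moved over \<open>a\<close> when it is smaller, and \<open>a\<^sup>-\<^sup>1\<close> over \<open>m\<close> when it is larger.\<close>

lemma normal_imp_reduced:
  assumes "normal w"
  shows "reduced w"
  unfolding reduced_def
proof (intro notI, elim exE conjE)
  fix p a m q
  assume w: "w = p @ a # m @ inv_letter a # q" and m: "\<forall>l\<in>set m. adj (fst l) (fst a)"
  show False
  proof (cases m)
    case Nil
    with w have "w = p @ a # inv_letter a # q" by simp
    with assms show False unfolding normal_def free_reduced_def by blast
  next
    case (Cons c m')
    with m have adj: "adj (fst c) (fst a)" by simp
    then have "fst c \<noteq> fst a" using adj_irrefl by metis
    then consider "fst c < fst a" | "fst a < fst c" by fastforce
    then have "movable (map fst w)"
    proof cases
      case 1
      have "map fst w = map fst p @ fst a # [] @ fst c # map fst (m' @ inv_letter a # q)"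
        by (simp add: w Cons)
      with 1 adj adj_sym show ?thesis unfolding movable_def by (metis empty_iff empty_set set_ConsD)
    next
      case 2
      have "map fst w = map fst (p @ [a]) @ fst c # map fst m' @ fst a # map fst q"
        by (simp add: w Cons)
      moreover have "\<forall>g\<in>set (fst c # map fst m'). adj g (fst a)"
        using m Cons by auto
      ultimately show ?thesis using 2 unfolding movable_def by blast
    qed
    with assms show False by (simp add: normal_def)
  qed
qed

lemma proj_Nil_iff: "proj w = proj [] \<longleftrightarrow> w = []"
proof
  assume eq: "proj w = proj []"
  show "w = []"
  proof (rule ccontr)
    assume "w \<noteq> []"
    then obtain l where "l \<in> set w" by (cases w) auto
    moreover have "proj w (fst l) (fst l) = []" using eq by (simp add: proj_def)
    ultimately show False by (auto simp: proj_def adj_irrefl filter_empty_conv)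
  qed
qed simp

lemma proj_eq_Cons:
  assumes "proj v = proj (a # u)"
  obtains v1 v2 where "v = v1 @ a # v2" "\<forall>l\<in>set v1. adj (fst l) (fst a)"
  by (rule front_of_proj[of a v]) (auto simp: assms proj_def)

lemma movable_if_late_smaller_letter:
  assumes "b # v = v1 @ a # v2" "b \<noteq> a" "\<forall>l\<in>set v1. adj (fst l) (fst a)"
  shows "adj (fst b) (fst a)" "fst a < fst b \<Longrightarrow> movable (map fst (b # v))"
proof -
  from assms obtain v1' where v1: "v1 = b # v1'" and v: "v = v1' @ a # v2"
    by (cases v1) auto
  with assms show "adj (fst b) (fst a)" by simp
  assume "fst a < fst b"
  moreover have "map fst (b # v) = [] @ fst b # map fst v1' @ fst a # map fst v2"
    by (simp add: v)
  moreover have "\<forall>g\<in>set (fst b # map fst v1'). adj g (fst a)"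
    using assms(3) v1 by auto
  ultimately show "movable (map fst (b # v))" unfolding movable_def by blast
qed

text \<open>Suppose that the first letters \<open>a\<close> and \<open>b\<close> differ. Each of them can be brought to the front of
  the other word, so the word that begins with the larger one is not normal.\<close>

lemma normal_eq_if_proj_eq:
  "normal u \<Longrightarrow> normal v \<Longrightarrow> proj u = proj v \<Longrightarrow> u = v"
proof (induction u arbitrary: v)
  case Nil
  then show ?case using proj_Nil_iff by metis
next
  case (Cons a u)
  then obtain b v' where v: "v = b # v'"
    using proj_Nil_iff by (metis list.exhaust)
  show ?case
  proof (cases "a = b")
    case True
    have "proj u x y = proj v' x y" for x y
      using Cons.prems(3) True unfolding fun_eq_iff proj_def v by (auto split: if_splits dest: spec[of _ x])
    moreover have "normal u" "normal v'"
      using Cons.prems normal_append[of "[_]" _ "[]"] v by simp_all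
    ultimately show ?thesis using Cons.IH True v by blast
  next
    case False
    from Cons.prems(3) obtain v1 v2 where "v = v1 @ a # v2" "\<forall>l\<in>set v1. adj (fst l) (fst a)"
      using proj_eq_Cons by metis
    with False v have 1: "adj (fst b) (fst a)" "fst a < fst b \<Longrightarrow> movable (map fst v)"
      using movable_if_late_smaller_letter by metis+
    from Cons.prems(3) v obtain u1 u2 where "a # u = u1 @ b # u2" "\<forall>l\<in>set u1. adj (fst l) (fst b)"
      using proj_eq_Cons by metis
    with False have 2: "fst b < fst a \<Longrightarrow> movable (map fst (a # u))"
      using movable_if_late_smaller_letter by metis
    have "fst a \<noteq> fst b" using 1(1) adj_irrefl by metis
    with 1(2) 2 Cons.prems show ?thesis
      unfolding normal_def by (meson linorder_neqE)
  qed
qed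

end

section \<open>Removing the twist\<close>

locale twisted_graph =
  fixes \<Gamma> :: "'a::linorder mixed_graph"
  assumes finite_mixed_graph: "finite_mixed_graph \<Gamma>"
begin

abbreviation S :: "'a letter set" where "S \<equiv> letters \<Gamma>"

lemma adjacent_verts: "adjacent \<Gamma> x y \<Longrightarrow> x \<in> verts \<Gamma> \<and> y \<in> verts \<Gamma>"
  using finite_mixed_graph by (auto simp: finite_mixed_graph_def adjacent_def)

sublocale commutation_graph "adjacent \<Gamma>"
proof
  show "adjacent \<Gamma> y x" if "adjacent \<Gamma> x y" for x y
    using that by (simp add: adjacent_def insert_commute)
  show "\<not> adjacent \<Gamma> x x" for x
    using finite_mixed_graph unfolding finite_mixed_graph_def adjacent_def
    by (metis card.empty card_insert_disjoint empty_iff finite.emptyI insert_absorb2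
        n_not_Suc_n numeral_2_eq_2)
qed

lemma directed_imp_adjacent: "directed \<Gamma> x y \<Longrightarrow> adjacent \<Gamma> x y"
  using finite_mixed_graph by (auto simp: finite_mixed_graph_def adjacent_def directed_def)

lemma not_directed_self [simp]: "\<not> directed \<Gamma> x x"
  using directed_imp_adjacent adj_irrefl by blast

lemma directed_asym: "directed \<Gamma> x y \<Longrightarrow> \<not> directed \<Gamma> y x"
  using not_directed_self[of x] by (auto simp: directed_def insert_commute)

lemma undirected_iff:
  "undirected \<Gamma> x y \<longleftrightarrow> adjacent \<Gamma> x y \<and> \<not> directed \<Gamma> x y \<and> \<not> directed \<Gamma> y x"
proof -
  have "{x, y} \<in> dir_edges \<Gamma> \<longleftrightarrow> directed \<Gamma> x y \<or> directed \<Gamma> y x"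
  proof
    assume "{x, y} \<in> dir_edges \<Gamma>"
    moreover from this have "{x, y} = {origin \<Gamma> {x, y}, terminus \<Gamma> {x, y}}"
      using finite_mixed_graph by (auto simp: finite_mixed_graph_def)
    ultimately show "directed \<Gamma> x y \<or> directed \<Gamma> y x"
      unfolding directed_def doubleton_eq_iff by (auto simp: insert_commute)
  qed (auto simp: directed_def insert_commute)
  then show ?thesis by (auto simp: undirected_def adjacent_def)
qed

lemma edge_rules_eq:
  "edge_rules \<Gamma> = {([(y, \<beta>), (x, \<alpha>)], [(x, \<alpha> \<noteq> directed \<Gamma> x y), (y, \<beta> \<noteq> directed \<Gamma> y x)]) | x y \<alpha> \<beta>.
     x < y \<and> adjacent \<Gamma> x y}" (is "_ = ?R")
proof
  show "edge_rules \<Gamma> \<subseteq> ?R"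
    using directed_asym directed_imp_adjacent adj_sym
    by (auto simp: edge_rules_def undirected_iff)
  show "?R \<subseteq> edge_rules \<Gamma>"
    using directed_asym directed_imp_adjacent
    by (auto simp: edge_rules_def undirected_iff)
qed

lemma initial_system_cases:
  assumes "(l, r) \<in> initial_system \<Gamma>"
  obtains (edge) x y \<alpha> \<beta> where "x < y" "adjacent \<Gamma> x y" "l = [(y, \<beta>), (x, \<alpha>)]"
      "r = [(x, \<alpha> \<noteq> directed \<Gamma> x y), (y, \<beta> \<noteq> directed \<Gamma> y x)]"
    | (vertex) z \<gamma> where "z \<in> verts \<Gamma>" "l = [(z, \<gamma>), (z, \<not> \<gamma>)]" "r = []"
  using assms unfolding initial_system_def edge_rules_eq vertex_rules_def by blast

text \<open>Changes the sign of each letter \<open>y\<close> by the parity of the number of letters \<open>g\<close> to its left with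
  \<open>[y, g\<rangle>\<close> a directed edge. Passing such a \<open>g\<close> changes both the sign of \<open>y\<close> and this parity, so
  in the result only the position of \<open>y\<close> changes. The argument \<open>f\<close> accumulates the parities.\<close>

primrec untwist :: "('a \<Rightarrow> bool) \<Rightarrow> 'a letter list \<Rightarrow> 'a letter list" where
  "untwist f [] = []"
| "untwist f (l # w) =
     (fst l, snd l \<noteq> f (fst l)) # untwist (\<lambda>y. f y \<noteq> directed \<Gamma> y (fst l)) w"

primrec pending_flips :: "('a \<Rightarrow> bool) \<Rightarrow> 'a letter list \<Rightarrow> 'a \<Rightarrow> bool" where
  "pending_flips f [] = f"
| "pending_flips f (l # w) = pending_flips (\<lambda>y. f y \<noteq> directed \<Gamma> y (fst l)) w"

lemma untwist_append: "untwist f (u @ v) = untwist f u @ untwist (pending_flips f u) v"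
  by (induction u arbitrary: f) auto

lemma map_fst_untwist [simp]: "map fst (untwist f w) = map fst w"
  by (induction w arbitrary: f) auto

lemma untwist_eq_iff: "untwist f u = untwist f v \<longleftrightarrow> u = v"
proof
  show "untwist f u = untwist f v \<Longrightarrow> u = v"
  proof (induction u arbitrary: f v)
    case Nil
    then show ?case by (cases v) auto
  next
    case (Cons a u)
    then obtain b v' where v: "v = b # v'" by (cases v) simp_all
    with Cons.prems have "fst a = fst b" by simp
    moreover from this Cons.prems v have "snd a = snd b"
      by simp blast
    moreover from calculation Cons.prems v
    have "untwist (\<lambda>y. f y \<noteq> directed \<Gamma> y (fst a)) u = untwist (\<lambda>y. f y \<noteq> directed \<Gamma> y (fst a)) v'"
      by simp
    then have "u = v'" by (rule Cons.IH)
    ultimately show ?case by (simp add: v prod_eq_iff)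
  qed
qed simp

lemma length_untwist [simp]: "length (untwist f w) = length w"
  by (metis length_map map_fst_untwist)

text \<open>Two neighbouring letters with the same vertex have the same parity of letters to their left
  since a vertex is not joined to itself.\<close>

lemma free_reduced_untwist:
  assumes "free_reduced w"
  shows "free_reduced (untwist f w)"
  unfolding free_reduced_def
proof (intro notI, elim exE)
  fix p a q
  assume eq: "untwist f w = p @ a # inv_letter a # q"
  define p' where "p' = take (length p) w"
  define w' where "w' = drop (length p) w"
  define g where "g = pending_flips f p'"
  have len: "length p + 2 \<le> length w"
    using arg_cong[OF eq, of length] by simp
  have w: "w = p' @ w'" by (simp add: p'_def w'_def)
  then have "untwist f p' @ untwist g w' = p @ a # inv_letter a # q"
    using eq by (simp add: untwist_append g_def)
  moreover have "length (untwist f p') = length p"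
    using len by (simp add: p'_def)
  ultimately have w': "untwist g w' = a # inv_letter a # q" by simp
  then obtain b v where "w' = b # v" by (cases w') simp_all
  moreover from this w' obtain c q' where "v = c # q'" by (cases v) simp_all
  ultimately have "w' = b # inv_letter b # q'"
    using w' by (auto simp: inv_letter_def prod_eq_iff)
  with w have "w = p' @ b # inv_letter b # q'" by simp
  with assms show False unfolding free_reduced_def by blast
qed

lemma normal_untwist: "normal w \<Longrightarrow> normal (untwist f w)"
  by (simp add: normal_def free_reduced_untwist)

text \<open>An edge rule untwists to the exchange of two letters without any change of signs, and a vertex
  rule to a vertex rule. Both sides leave the same parities to the letters that follow.\<close>

lemma foldr_act_rule:
  assumes "(l, r) \<in> initial_system \<Gamma>" "reduced w"
  shows "foldr act (untwist f l) (proj w) = foldr act (untwist f r) (proj w)"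
    and "pending_flips f l = pending_flips f r"
proof -
  have "foldr act (untwist f l) (proj w) = foldr act (untwist f r) (proj w) \<and>
    pending_flips f l = pending_flips f r"
    using assms(1)
  proof (cases rule: initial_system_cases)
    case (edge x y \<alpha> \<beta>)
    have "act (y, b) (act (x, a) F) = act (x, a) (act (y, b) F)" for a b F
      using edge adj_sym by (intro act_commute) simp
    with edge show ?thesis by (simp add: fun_eq_iff) (cases "f x"; cases "f y"; cases \<alpha>; cases \<beta>; auto)
  next
    case (vertex z \<gamma>)
    then show ?thesis
      using act_inverse[OF assms(2), of "(z, \<gamma> \<noteq> f z)"]
      by (cases \<gamma>; cases "f z") (auto simp: inv_letter_def fun_eq_iff)
  qed
  then show "foldr act (untwist f l) (proj w) = foldr act (untwist f r) (proj w)"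
    and "pending_flips f l = pending_flips f r" by auto
qed

text \<open>The element of the untwisted group that corresponds to a word, as an invariant of its
  congruence class.\<close>

definition word_value :: "'a letter list \<Rightarrow> 'a \<Rightarrow> 'a \<Rightarrow> 'a letter list" where
  "word_value w = foldr act (untwist (\<lambda>_. False) w) (proj [])"

lemma reduced_Nil: "reduced []"
  by (simp add: reduced_def)

lemma word_value_rstep:
  assumes "(u, v) \<in> rstep S (initial_system \<Gamma>)"
  shows "word_value u = word_value v"
proof -
  obtain p l r q where "u = p @ l @ q" "v = p @ r @ q" and lr: "(l, r) \<in> initial_system \<Gamma>"
    using assms by (auto simp: rstep_def)
  moreover define f where "f = pending_flips (\<lambda>_. False) p"
  moreover obtain w where "reduced w"
      "foldr act (untwist (pending_flips f l) q) (proj []) = proj w"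
    using foldr_act_reduced[OF reduced_Nil] .
  ultimately show ?thesis
    using foldr_act_rule[OF lr, of w f] by (simp add: word_value_def untwist_append)
qed

abbreviation congruent_words :: "('a letter list \<times> 'a letter list) set" where
  "congruent_words \<equiv> (rstep S (initial_system \<Gamma>) \<union> (rstep S (initial_system \<Gamma>))\<inverse>)\<^sup>*"

lemma word_value_congruent: "(u, v) \<in> congruent_words \<Longrightarrow> word_value u = word_value v"
  by (induction rule: rtrancl_induct) (auto dest: word_value_rstep)

text \<open>Congruent words have the same value. The value of a normal word is the family of projections of
  its untwisted form, and this determines the word.\<close>

lemma normal_unique:
  assumes "(u, v) \<in> congruent_words" "normal u" "normal v"
  shows "u = v"
proof -
  have "word_value w = proj (untwist (\<lambda>_. False) w)" if "normal w" for w
    unfolding word_value_def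
    using that by (intro foldr_act_of_reduced normal_imp_reduced normal_untwist)
  with assms word_value_congruent
  have "proj (untwist (\<lambda>_. False) u) = proj (untwist (\<lambda>_. False) v)" by metis
  with assms show ?thesis
    using normal_eq_if_proj_eq normal_untwist untwist_eq_iff by blast
qed

end

section \<open>The completed system\<close>

lemma rstep_mono: "R \<subseteq> R' \<Longrightarrow> rstep X R \<subseteq> rstep X R'"
  unfolding rstep_def by blast

lemma rstepI: "(l, r) \<in> R \<Longrightarrow> p \<in> lists X \<Longrightarrow> q \<in> lists X \<Longrightarrow> (p @ l @ q, p @ r @ q) \<in> rstep X R"
  unfolding rstep_def by blast

lemma rstep_context:
  assumes "(u, v) \<in> rstep X R" "p \<in> lists X" "q \<in> lists X"
  shows "(p @ u @ q, p @ v @ q) \<in> rstep X R"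
proof -
  obtain p' l r q' where "u = p' @ l @ q'" "v = p' @ r @ q'" "(l, r) \<in> R" "p' \<in> lists X" "q' \<in> lists X"
    using assms(1) by (auto simp: rstep_def)
  then show ?thesis
    using rstepI[of l r R "p @ p'" X "q' @ q"] assms by simp
qed

lemma overlapsE:
  assumes "ov \<in> overlaps R"
  obtains u s v r1 r2 where "ov = Overlap (u @ s, r1) (s @ v, r2) u s v" "s \<noteq> []"
    "(u @ s, r1) \<in> R" "(s @ v, r2) \<in> R"
  using assms by (auto simp: overlaps_def)

context twisted_graph
begin

definition flip_by :: "'a \<Rightarrow> 'a letter \<Rightarrow> 'a letter" where
  "flip_by x l = (fst l, snd l \<noteq> directed \<Gamma> (fst l) x)"

text \<open>The word obtained from \<open>w x\<^sup>e\<close> by moving \<open>x\<^sup>e\<close> to the front.\<close>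

definition pull :: "'a letter list \<Rightarrow> 'a \<Rightarrow> bool \<Rightarrow> 'a letter list" where
  "pull w x e = (x, e \<noteq> odd (length (filter (directed \<Gamma> x) (map fst w)))) # map (flip_by x) w"

text \<open>For these \<open>w\<close>, the words \<open>w x\<close> are the minimal freely reduced words that are movable. That \<open>w\<close> is
  normal keeps the completed system reduced: no left side contains another one.\<close>

definition pullable :: "'a letter list \<Rightarrow> 'a \<Rightarrow> bool" where
  "pullable w x \<longleftrightarrow> w \<noteq> [] \<and> x < fst (hd w) \<and> (\<forall>l\<in>set (tl w). fst l < x) \<and>
     (\<forall>l\<in>set w. adjacent \<Gamma> (fst l) x) \<and> normal w"

definition completed_system :: "'a letter rule set" where
  "completed_system = vertex_rules \<Gamma> \<union> {(w @ [(x, e)], pull w x e) | w x e. pullable w x}"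

text \<open>The system reached after \<open>n\<close> steps of the completion; see \<open>kb_completion_iff\<close>.\<close>

definition truncated_system :: "nat \<Rightarrow> 'a letter rule set" where
  "truncated_system n = {\<rho> \<in> completed_system. length (fst \<rho>) \<le> n + 2}"

lemma fst_flip_by [simp]: "fst (flip_by x l) = fst l"
  by (simp add: flip_by_def)

lemma flip_by_eq_iff [simp]: "flip_by x l = flip_by x l' \<longleftrightarrow> l = l'"
  by (auto simp: flip_by_def prod_eq_iff)

lemma commutation_rules_eq:
  "commutation_rules \<Gamma> gs x = {(w @ [(x, e)], pull w x e) | w e. map fst w = gs}" (is "?L = ?R")
proof
  have flip: "map (\<lambda>(g, j). (g, j \<noteq> directed \<Gamma> g x)) w = map (flip_by x) w" for w
    by (simp add: flip_by_def case_prod_beta)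
  show "?L \<subseteq> ?R"
  proof
    fix \<rho> assume "\<rho> \<in> ?L"
    then obtain js e where "length js = length gs" and \<rho>: "\<rho> = (zip gs js @ [(x, e)],
        (x, e \<noteq> odd (length (filter (directed \<Gamma> x) gs))) # map (flip_by x) (zip gs js))"
      unfolding commutation_rules_def flip by blast
    then have gs: "map fst (zip gs js) = gs" by simp
    then have "\<rho> = (zip gs js @ [(x, e)], pull (zip gs js) x e)" by (simp only: \<rho> pull_def)
    with gs show "\<rho> \<in> ?R" by blast
  qed
  show "?R \<subseteq> ?L"
  proof
    fix \<rho> assume "\<rho> \<in> ?R"
    then obtain w e where gs: "map fst w = gs" and \<rho>: "\<rho> = (w @ [(x, e)], pull w x e)"
      by blast
    have w: "w = zip gs (map snd w)" "length (map snd w) = length gs"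
      by (simp_all add: gs[symmetric] zip_map_fst_snd)
    have "\<rho> = (zip gs (map snd w) @ [(x, e)],
        (x, e \<noteq> odd (length (filter (directed \<Gamma> x) gs))) # map (flip_by x) (zip gs (map snd w)))"
      using \<rho> w(1) by (simp only: pull_def gs)
    with w(2) show "\<rho> \<in> ?L" unfolding commutation_rules_def flip by blast
  qed
qed

lemma completed_system_cases:
  assumes "(l, r) \<in> completed_system"
  obtains (vertex) z \<gamma> where "z \<in> verts \<Gamma>" "l = [(z, \<gamma>), (z, \<not> \<gamma>)]" "r = []"
    | (pull) w x e where "pullable w x" "l = w @ [(x, e)]" "r = pull w x e"
  using assms unfolding completed_system_def vertex_rules_def by blast

lemma pullable_letters:
  assumes "pullable w x"
  shows "w \<in> lists S" "x \<in> verts \<Gamma>" "set (map fst w) \<subseteq> verts \<Gamma>"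
  using assms adjacent_verts by (auto simp: pullable_def letters_def neq_Nil_conv)

lemma completed_system_letters:
  assumes "(l, r) \<in> completed_system"
  shows "l \<in> lists S" "r \<in> lists S"
proof -
  have "l \<in> lists S \<and> r \<in> lists S"
    using assms
  proof (cases rule: completed_system_cases)
    case (vertex z \<gamma>)
    then show ?thesis by (simp add: letters_def)
  next
    case (pull w x e)
    then show ?thesis
      using pullable_letters[OF pull(1)]
      by (auto simp: pull_def letters_def flip_by_def lists_eq_set)
  qed
  then show "l \<in> lists S" "r \<in> lists S" by auto
qed

lemma movable_pull:
  assumes "pullable w x"
  shows "movable (map fst (w @ [(x, e)]))"
proof -
  obtain a w' where w: "w = a # w'"
    using assms by (cases w) (auto simp: pullable_def)
  have "map fst (w @ [(x, e)]) = [] @ fst a # map fst w' @ x # []" by (simp add: w)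
  moreover have "x < fst a" "\<forall>g\<in>set (fst a # map fst w'). adjacent \<Gamma> g x"
    using assms w by (auto simp: pullable_def)
  ultimately show ?thesis unfolding movable_def by blast
qed

lemma lhs_not_normal:
  assumes "(l, r) \<in> completed_system"
  shows "\<not> normal l"
  using assms
proof (cases rule: completed_system_cases)
  case (vertex z \<gamma>)
  then have "l = [] @ (z, \<gamma>) # inv_letter (z, \<gamma>) # []" by (simp add: inv_letter_def)
  then show ?thesis unfolding normal_def free_reduced_def by blast
next
  case (pull w x e)
  then show ?thesis using movable_pull by (auto simp: normal_def)
qed

lemma normal_irreducible:
  assumes "normal w" "R \<subseteq> completed_system"
  shows "irreducible_word S R w"
  unfolding irreducible_word_def
proof (intro notI, elim exE)
  fix w' assume "(w, w') \<in> rstep S R"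
  then obtain p l r q where "w = p @ l @ q" "(l, r) \<in> R"
    by (auto simp: rstep_def)
  with assms normal_append[of p l q] lhs_not_normal show False by blast
qed

text \<open>In a minimal movable word \<open>b u z\<close> the letters of \<open>u\<close> are smaller than \<open>z\<close>: otherwise a proper
  suffix would be movable.\<close>

lemma minimal_non_normal_is_lhs:
  assumes "w \<in> lists S" "\<not> normal w"
    and shorter: "\<And>u v. w = u @ v \<Longrightarrow> u \<noteq> [] \<Longrightarrow> v \<noteq> [] \<Longrightarrow> normal u \<and> normal v"
  obtains r where "(w, r) \<in> completed_system"
proof (cases "free_reduced w")
  case False
  then obtain p a q where w: "w = p @ a # inv_letter a # q"
    by (auto simp: free_reduced_def)
  have nn: "\<not> normal (p' @ a # inv_letter a # q')" for p' q'
    unfolding normal_def free_reduced_def by blast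
  have "q = []"
    using shorter[of "p @ [a, inv_letter a]" q] nn[of p "[]"] by (auto simp: w)
  moreover have "p = []"
    using shorter[of p "a # inv_letter a # q"] nn[of "[]" q] by (auto simp: w)
  ultimately have "w = [(fst a, snd a), (fst a, \<not> snd a)]"
    by (simp add: w inv_letter_def)
  moreover from this assms have "fst a \<in> verts \<Gamma>" by (simp add: letters_def)
  ultimately have "(w, []) \<in> completed_system"
    unfolding completed_system_def vertex_rules_def by blast
  with that show thesis .
next
  case True
  with assms have "movable (map fst w)" by (simp add: normal_def)
  then obtain p' b' u' x q' where eq: "map fst w = p' @ b' # u' @ x # q'" and "x < b'"
      "\<forall>g\<in>set (b' # u'). adjacent \<Gamma> g x"
    unfolding movable_def by blast
  from eq obtain p b u z q where w: "w = p @ b # u @ z # q"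
      and b: "b' = fst b" and u: "u' = map fst u" and z: "x = fst z"
    by (auto simp: map_eq_append_conv map_eq_Cons_conv append_eq_map_conv Cons_eq_map_conv)
  have less: "fst z < fst b" and adj: "\<forall>l\<in>set (b # u). adjacent \<Gamma> (fst l) (fst z)"
    using \<open>x < b'\<close> \<open>\<forall>g\<in>set (b' # u'). adjacent \<Gamma> g x\<close> b u z by auto
  have mov: "\<not> normal (r @ c # v @ z # s)"
    if "fst z < fst c" "\<forall>l\<in>set (c # v). adjacent \<Gamma> (fst l) (fst z)" for r c v s
  proof -
    have "map fst (r @ c # v @ z # s) = map fst r @ fst c # map fst v @ fst z # map fst s" by simp
    moreover have "\<forall>g\<in>set (fst c # map fst v). adjacent \<Gamma> g (fst z)" using that by simp
    ultimately have "movable (map fst (r @ c # v @ z # s))"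
      using that(1) unfolding movable_def by blast
    then show ?thesis by (simp add: normal_def)
  qed
  have "q = []"
    using shorter[of "p @ b # u @ [z]" q] mov[OF less adj, of p "[]"] by (auto simp: w)
  have "p = []"
    using shorter[of p "b # u @ z # q"] mov[OF less adj, of "[]" q] by (auto simp: w)
  have w: "w = (b # u) @ [(fst z, snd z)]"
    using w \<open>p = []\<close> \<open>q = []\<close> by simp
  have "fst l < fst z" if l: "l \<in> set u" for l
  proof (rule ccontr)
    assume "\<not> fst l < fst z"
    moreover have "fst l \<noteq> fst z" using adj l adj_irrefl by (metis list.set_intros(2))
    ultimately have gt: "fst z < fst l" by simp
    obtain u1 u2 where "u = u1 @ l # u2" using l by (meson split_list)
    then have "\<not> normal ([] @ l # u2 @ z # [])"
      using adj by (intro mov[OF gt]) simp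
    moreover have "normal (l # u2 @ [z])"
      using shorter[of "b # u1" "l # u2 @ [z]"] w \<open>u = u1 @ l # u2\<close> by simp
    ultimately show False by simp
  qed
  moreover have "normal (b # u)"
    using shorter[of "b # u" "[z]"] w by simp
  ultimately have "pullable (b # u) (fst z)"
    using less adj by (simp add: pullable_def)
  then have "(w, pull (b # u) (fst z) (snd z)) \<in> completed_system"
    unfolding completed_system_def w by blast
  with that show thesis .
qed

lemma non_normal_contains_lhs:
  assumes "w \<in> lists S" "\<not> normal w"
  shows "\<exists>p l r q. w = p @ l @ q \<and> (l, r) \<in> completed_system"
  using assms
proof (induction "length w" arbitrary: w rule: less_induct)
  case less
  show ?case
  proof (cases "\<forall>u v. w = u @ v \<longrightarrow> u \<noteq> [] \<longrightarrow> v \<noteq> [] \<longrightarrow> normal u \<and> normal v")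
    case True
    then obtain r where "(w, r) \<in> completed_system"
      using minimal_non_normal_is_lhs[OF less.prems] by blast
    then have "w = [] @ w @ [] \<and> (w, r) \<in> completed_system" by simp
    then show ?thesis by blast
  next
    case False
    then obtain u v where w: "w = u @ v" "u \<noteq> []" "v \<noteq> []" and "\<not> normal u \<or> \<not> normal v" by blast
    then consider "\<not> normal u" | "\<not> normal v" by blast
    then show ?thesis
    proof cases
      case 1
      then obtain p l r q where "u = p @ l @ q" "(l, r) \<in> completed_system"
        using less.hyps[of u] less.prems w by auto
      then have "w = p @ l @ (q @ v) \<and> (l, r) \<in> completed_system" using w by simp
      then show ?thesis by blast
    next
      case 2
      then obtain p l r q where "v = p @ l @ q" "(l, r) \<in> completed_system"
        using less.hyps[of v] less.prems w by auto
      then have "w = (u @ p) @ l @ q \<and> (l, r) \<in> completed_system" using w by simp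
      then show ?thesis by blast
    qed
  qed
qed

text \<open>A word that is not normal contains a left side; if no rule of length at most \<open>n + 2\<close> applies to a
  word of length at most \<open>n + 3\<close>, this left side is the whole word.\<close>

lemma irreducible_truncated:
  assumes "w \<in> lists S" "length w \<le> n + 3" "irreducible_word S (truncated_system n) w"
    and "\<not> normal w"
  obtains r where "(w, r) \<in> truncated_system (Suc n) - truncated_system n"
proof -
  obtain p l r q where w: "w = p @ l @ q" and lr: "(l, r) \<in> completed_system"
    using non_normal_contains_lhs assms(1,4) by blast
  have "(l, r) \<notin> truncated_system n"
    using assms(1,3) w unfolding irreducible_word_def rstep_def by auto
  with lr have "n + 2 < length l" by (simp add: truncated_system_def)
  moreover have "length p + length l + length q \<le> n + 3" using assms(2) w by simp
  ultimately have "length p = 0" "length q = 0" "length l = n + 3" by linarith+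
  then have "w = l" "length l = n + 3" using w by simp_all
  with lr \<open>(l, r) \<notin> truncated_system n\<close> have "(w, r) \<in> truncated_system (Suc n) - truncated_system n"
    by (simp add: truncated_system_def)
  with that show thesis .
qed

lemma free_reduced_map_flip_by:
  assumes "free_reduced w"
  shows "free_reduced (map (flip_by x) w)"
  unfolding free_reduced_def
proof (intro notI, elim exE)
  fix p a q
  assume "map (flip_by x) w = p @ a # inv_letter a # q"
  then obtain p' b c q' where w: "w = p' @ b # c # q'" "flip_by x b = a" "flip_by x c = inv_letter a"
    by (auto simp: map_eq_append_conv map_eq_Cons_conv append_eq_map_conv Cons_eq_map_conv)
  then have "c = inv_letter b"
    by (auto simp: flip_by_def inv_letter_def prod_eq_iff)
  with w assms show False unfolding free_reduced_def by blast
qed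

text \<open>Since \<open>x\<close> is smaller than the first letter \<open>a\<close> of \<open>w\<close>, a letter that could be moved over \<open>x\<close> would
  be smaller than \<open>a\<close> and could already be moved over \<open>a\<close> within \<open>w\<close>.\<close>

lemma normal_pull:
  assumes "pullable w x"
  shows "normal (pull w x e)"
  unfolding normal_def
proof
  obtain a w' where w: "w = a # w'" and gt: "x < fst a"
    using assms by (cases w) (auto simp: pullable_def)
  have nw: "free_reduced w" "\<not> movable (map fst w)"
    using assms by (auto simp: pullable_def normal_def)
  show "free_reduced (pull w x e)"
    unfolding free_reduced_def
  proof (intro notI, elim exE)
    fix p c q
    assume eq: "pull w x e = p @ c # inv_letter c # q"
    show False
    proof (cases p)
      case Nil
      with eq have "fst c = x" "fst (inv_letter c) = fst a"
        by (auto simp: pull_def w flip_by_def prod_eq_iff)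
      with gt show False by simp
    next
      case (Cons d p')
      with eq have "map (flip_by x) w = p' @ c # inv_letter c # q" by (simp add: pull_def)
      with free_reduced_map_flip_by[OF nw(1)] show False unfolding free_reduced_def by blast
    qed
  qed
  show "\<not> movable (map fst (pull w x e))"
    unfolding movable_def
  proof (intro notI, elim exE conjE)
    fix p b u z q
    assume "map fst (pull w x e) = p @ b # u @ z # q" and less: "z < b"
      and adj: "\<forall>g\<in>set (b # u). adjacent \<Gamma> g z"
    then have eq: "x # map fst w = p @ b # u @ z # q" by (simp add: pull_def comp_def)
    show False
    proof (cases p)
      case Nil
      with eq have b: "b = x" and tail: "fst a # map fst w' = u @ z # q" by (auto simp: w)
      show False
      proof (cases u)
        case Nil
        with tail less gt b show False by simp
      next
        case (Cons g u')
        with tail have "map fst w = [] @ fst a # u' @ z # q" "g = fst a" by (auto simp: w)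
        moreover have "z < fst a" using less gt b by simp
        moreover have "\<forall>h\<in>set (fst a # u'). adjacent \<Gamma> h z"
          using adj Cons calculation(2) by simp
        ultimately have "movable (map fst w)"
          unfolding movable_def by blast
        with nw show False by simp
      qed
    next
      case (Cons d p')
      with eq have "map fst w = p' @ b # u @ z # q" by simp
      with less adj nw show False unfolding movable_def by blast
    qed
  qed
qed

lemma pull_inject:
  assumes "pull w x e = pull w' x' e'"
  shows "w = w' \<and> x = x' \<and> e = e'"
proof -
  from assms have x: "x = x'" and "map (flip_by x) w = map (flip_by x') w'"
    and e: "(e \<noteq> odd (length (filter (directed \<Gamma> x) (map fst w)))) =
      (e' \<noteq> odd (length (filter (directed \<Gamma> x') (map fst w'))))"
    unfolding pull_def by auto
  moreover have "inj (flip_by x)" by (auto intro: injI)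
  ultimately have "w = w'" by (simp add: inj_map_eq_map)
  with x e show ?thesis by auto
qed

lemma long_rule:
  assumes "(l, r) \<in> truncated_system (Suc n) - truncated_system n"
  obtains w x e where "pullable w x" "l = w @ [(x, e)]" "r = pull w x e" "length w = n + 2"
proof -
  from assms have "(l, r) \<in> completed_system" and len: "length l = n + 3"
    by (auto simp: truncated_system_def)
  then show thesis
    by (cases rule: completed_system_cases) (auto intro: that)
qed

section \<open>Termination, equivalence and confluence\<close>

lemma congruent_sym: "(u, v) \<in> congruent_words \<Longrightarrow> (v, u) \<in> congruent_words"
  by (rule symD[OF sym_rtrancl[OF sym_Un_converse]])

lemma congruent_trans:
  "(u, v) \<in> congruent_words \<Longrightarrow> (v, w) \<in> congruent_words \<Longrightarrow> (u, w) \<in> congruent_words"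
  by (rule rtrancl_trans)

lemma congruent_context:
  assumes "(u, v) \<in> congruent_words" "p \<in> lists S" "q \<in> lists S"
  shows "(p @ u @ q, p @ v @ q) \<in> congruent_words"
  using assms(1)
proof (induction rule: rtrancl_induct)
  case (step v w)
  then have "(p @ v @ q, p @ w @ q) \<in> rstep S (initial_system \<Gamma>) \<union> (rstep S (initial_system \<Gamma>))\<inverse>"
    using rstep_context assms by blast
  with step.IH show ?case by (rule rtrancl_into_rtrancl)
qed simp

lemma initial_rule_congruent:
  assumes "(l, r) \<in> initial_system \<Gamma>"
  shows "(l, r) \<in> congruent_words"
proof -
  have "(l, r) \<in> rstep S (initial_system \<Gamma>)"
    using rstepI[OF assms, of "[]" S "[]"] by simp
  then show ?thesis by blast
qed

lemma edge_rule:
  assumes "x < y" "adjacent \<Gamma> x y"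
  shows "([(y, \<beta>), (x, \<alpha>)], [(x, \<alpha> \<noteq> directed \<Gamma> x y), (y, \<beta> \<noteq> directed \<Gamma> y x)]) \<in> initial_system \<Gamma>"
  using assms unfolding initial_system_def edge_rules_eq by blast

text \<open>For \<open>g < x\<close> the edge rule is used from right to left; the sign changes are involutions, so they
  are the same in both directions.\<close>

lemma swap_congruent:
  assumes "adjacent \<Gamma> g x"
  shows "([(g, j), (x, e)], [(x, e \<noteq> directed \<Gamma> x g), (g, j \<noteq> directed \<Gamma> g x)]) \<in> congruent_words"
proof -
  have "g \<noteq> x" using assms adj_irrefl by metis
  then consider "x < g" | "g < x" by fastforce
  then show ?thesis
  proof cases
    case 1
    show ?thesis by (rule initial_rule_congruent[OF edge_rule[OF 1 adj_sym[OF assms]]])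
  next
    case 2
    have "([(x, e \<noteq> directed \<Gamma> x g), (g, j \<noteq> directed \<Gamma> g x)], [(g, j), (x, e)]) \<in> initial_system \<Gamma>"
      using edge_rule[OF 2 assms, of "e \<noteq> directed \<Gamma> x g" "j \<noteq> directed \<Gamma> g x"]
      by (cases "directed \<Gamma> x g"; cases "directed \<Gamma> g x") simp_all
    then show ?thesis by (intro congruent_sym[OF initial_rule_congruent])
  qed
qed

lemma pull_congruent:
  assumes "\<forall>l\<in>set w. adjacent \<Gamma> (fst l) x"
  shows "(w @ [(x, e)], pull w x e) \<in> congruent_words"
  using assms
proof (induction w)
  case Nil
  then show ?case by (simp add: pull_def)
next
  case (Cons l w)
  define e' where "e' = (e \<noteq> odd (length (filter (directed \<Gamma> x) (map fst w))))"
  have verts: "\<forall>k\<in>set (l # w). fst k \<in> verts \<Gamma>"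
    using Cons.prems adjacent_verts by blast
  have l: "l \<in> S" and w: "map (flip_by x) w \<in> lists S"
    using verts by (auto simp: letters_def flip_by_def mem_Times_iff)
  have "([l] @ (w @ [(x, e)]) @ [], [l] @ pull w x e @ []) \<in> congruent_words"
    using Cons l by (intro congruent_context) auto
  moreover have "[l] @ pull w x e @ [] = [] @ [(fst l, snd l), (x, e')] @ map (flip_by x) w"
    by (simp add: pull_def e'_def)
  moreover have "([] @ [(fst l, snd l), (x, e')] @ map (flip_by x) w,
      [] @ [(x, e' \<noteq> directed \<Gamma> x (fst l)), (fst l, snd l \<noteq> directed \<Gamma> (fst l) x)] @ map (flip_by x) w)
      \<in> congruent_words"
    using Cons.prems w by (intro congruent_context swap_congruent) auto
  moreover have "[] @ [(x, e' \<noteq> directed \<Gamma> x (fst l)), (fst l, snd l \<noteq> directed \<Gamma> (fst l) x)] @ map (flip_by x) w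
      = pull (l # w) x e"
    by (auto simp: pull_def e'_def flip_by_def)
  ultimately show ?case
    using congruent_trans by simp
qed

lemma rule_congruent:
  assumes "(l, r) \<in> completed_system"
  shows "(l, r) \<in> congruent_words"
  using assms
proof (cases rule: completed_system_cases)
  case (vertex z \<gamma>)
  then have "(l, r) \<in> initial_system \<Gamma>"
    unfolding initial_system_def vertex_rules_def by blast
  then show ?thesis by (rule initial_rule_congruent)
next
  case (pull w x e)
  then show ?thesis using pull_congruent by (simp add: pullable_def)
qed

lemma rsteps_congruent:
  assumes "(u, v) \<in> (rstep S R)\<^sup>*" "R \<subseteq> completed_system"
  shows "(u, v) \<in> congruent_words"
  using assms(1)
proof (induction rule: rtrancl_induct)
  case (step v w)
  then obtain p l r q where "v = p @ l @ q" "w = p @ r @ q" "(l, r) \<in> R" "p \<in> lists S" "q \<in> lists S"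
    by (auto simp: rstep_def)
  then have "(v, w) \<in> congruent_words"
    using congruent_context rule_congruent assms(2) by blast
  with step.IH show ?case by (rule congruent_trans)
qed simp

lemma pullable_singleton: "x < fst g \<Longrightarrow> adjacent \<Gamma> (fst g) x \<Longrightarrow> pullable [g] x"
  by (auto simp: pullable_def normal_def free_reduced_def movable_def Cons_eq_append_conv)

lemma truncated_0: "truncated_system 0 = initial_system \<Gamma>"
proof
  show "truncated_system 0 \<subseteq> initial_system \<Gamma>"
  proof
    fix \<rho> assume "\<rho> \<in> truncated_system 0"
    then obtain l r where \<rho>: "\<rho> = (l, r)" "(l, r) \<in> completed_system" "length l \<le> 2"
      by (cases \<rho>) (auto simp: truncated_system_def)
    from \<rho>(2) show "\<rho> \<in> initial_system \<Gamma>"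
    proof (cases rule: completed_system_cases)
      case (vertex z \<gamma>)
      with \<rho> show ?thesis unfolding initial_system_def vertex_rules_def by blast
    next
      case (pull w x e)
      then obtain g where w: "w = [g]"
        using \<rho>(3) by (cases w) (auto simp: pullable_def)
      then have "x < fst g" "adjacent \<Gamma> x (fst g)"
        using pull adj_sym by (auto simp: pullable_def)
      from edge_rule[OF this, of "snd g" e] pull(2,3) \<rho>(1) w show ?thesis
        by (cases "directed \<Gamma> x (fst g)") (simp_all add: pull_def flip_by_def)
    qed
  qed
  show "initial_system \<Gamma> \<subseteq> truncated_system 0"
  proof
    fix \<rho> assume "\<rho> \<in> initial_system \<Gamma>"
    moreover obtain l r where \<rho>: "\<rho> = (l, r)" by (cases \<rho>)
    ultimately have "(l, r) \<in> initial_system \<Gamma>" by simp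
    then show "\<rho> \<in> truncated_system 0"
    proof (cases rule: initial_system_cases)
      case (edge x y \<alpha> \<beta>)
      then have "pullable [(y, \<beta>)] x"
        using adj_sym by (intro pullable_singleton) auto
      moreover have "l = [(y, \<beta>)] @ [(x, \<alpha>)]" "r = pull [(y, \<beta>)] x \<alpha>"
        using edge by (auto simp: pull_def flip_by_def)
      ultimately have "(l, r) \<in> completed_system"
        unfolding completed_system_def by blast
      then show ?thesis using edge \<rho> by (simp add: truncated_system_def)
    next
      case (vertex z \<gamma>)
      then show ?thesis
        using \<rho> by (auto simp: truncated_system_def completed_system_def vertex_rules_def)
    qed
  qed
qed

lemma truncated_subset: "truncated_system n \<subseteq> completed_system"
  by (auto simp: truncated_system_def)

lemma truncated_mono: "m \<le> n \<Longrightarrow> truncated_system m \<subseteq> truncated_system n"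
  by (auto simp: truncated_system_def)

lemma Union_truncated: "(\<Union>n. truncated_system n) = completed_system"
proof
  show "completed_system \<subseteq> (\<Union>n. truncated_system n)"
  proof
    fix \<rho> assume "\<rho> \<in> completed_system"
    then have "\<rho> \<in> truncated_system (length (fst \<rho>))" by (simp add: truncated_system_def)
    then show "\<rho> \<in> (\<Union>n. truncated_system n)" by blast
  qed
qed (use truncated_subset in blast)

lemma rule_decreasing:
  assumes "(l, r) \<in> completed_system"
  shows "length r < length l \<or> length r = length l \<and>
    (\<exists>a l' b r'. l = a # l' \<and> r = b # r' \<and> fst b < fst a)"
  using assms
proof (cases rule: completed_system_cases)
  case (pull w x e)
  then show ?thesis by (cases w) (auto simp: pull_def pullable_def)
qed simp

text \<open>The order of a linearly ordered type of vertices need not be well-founded, but its restriction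
  to the finitely many letters of the graph is.\<close>

definition letter_order_on :: "('a letter \<times> 'a letter) set" where
  "letter_order_on = letter_order \<inter> S \<times> S"

lemma wf_letter_order_on: "wf letter_order_on"
proof (rule finite_acyclic_wf)
  have "finite S"
    using finite_mixed_graph by (simp add: letters_def finite_mixed_graph_def)
  then show "finite letter_order_on" by (simp add: letter_order_on_def)
  have "trans letter_order_on"
    by (rule transI) (auto simp: letter_order_on_def letter_order_def)
  moreover have "(a, a) \<notin> letter_order_on" for a
    by (auto simp: letter_order_on_def letter_order_def)
  ultimately show "acyclic letter_order_on"
    by (simp add: acyclic_def trancl_id)
qed

lemma rule_decreasing_lenlex:
  assumes "(l, r) \<in> completed_system" "letter_order_on \<subseteq> Q"
  shows "(r, l) \<in> lenlex Q"
  using rule_decreasing[OF assms(1)]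
proof (elim disjE conjE exE)
  assume "length r < length l"
  then show ?thesis by (simp add: lenlex_conv)
next
  fix a l' b r'
  assume "length r = length l" "l = a # l'" "r = b # r'" "fst b < fst a"
  moreover from this have "a \<in> S" "b \<in> S"
    using completed_system_letters[OF assms(1)] by auto
  moreover have "(b, a) \<in> letter_order"
    using \<open>fst b < fst a\<close> by (cases a; cases b) (simp add: letter_order_def)
  ultimately show ?thesis
    using assms(2) by (auto simp: Cons_lenlex_iff letter_order_on_def)
qed

lemma wf_rstep: "wf ((rstep S completed_system)\<inverse>)"
proof (rule wf_subset)
  show "wf (lenlex letter_order_on)"
    using wf_letter_order_on by blast
  have irr: "irrefl letter_order_on"
    by (rule irreflI) (auto simp: letter_order_on_def letter_order_def)
  show "(rstep S completed_system)\<inverse> \<subseteq> lenlex letter_order_on"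
  proof
    fix uv assume "uv \<in> (rstep S completed_system)\<inverse>"
    then obtain p l r q where uv: "uv = (p @ r @ q, p @ l @ q)" and lr: "(l, r) \<in> completed_system"
      by (auto simp: rstep_def)
    show "uv \<in> lenlex letter_order_on"
      using lenlex_append1[OF rule_decreasing_lenlex[OF lr subset_refl], of q q] irr by (simp add: uv)
  qed
qed

lemma rule_shortlex: "(l, r) \<in> completed_system \<Longrightarrow> (r, l) \<in> shortlex"
  by (erule rule_decreasing_lenlex) (simp add: letter_order_on_def)

lemma shortlex_asym: "(u, v) \<in> (shortlex :: ('a letter list \<times> 'a letter list) set) \<Longrightarrow> (v, u) \<notin> shortlex"
proof -
  have "asym (letter_order :: ('a letter \<times> 'a letter) set)"
    by (rule asymI) (auto simp: letter_order_def)
  then show "(u, v) \<in> (shortlex :: ('a letter list \<times> 'a letter list) set) \<Longrightarrow> (v, u) \<notin> shortlex"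
    by (rule asymD[OF asym_lenlex])
qed

lemma noetherian_completed: "noetherian S completed_system"
  using wf_rstep unfolding noetherian_def wf_iff_no_infinite_down_chain by simp

lemma rsteps_words:
  assumes "(u, v) \<in> (rstep S R)\<^sup>*" "R \<subseteq> completed_system" "u \<in> lists S"
  shows "v \<in> lists S"
    and "length v < length u \<or> length v = length u \<and> fst ` set v = fst ` set u"
proof -
  have rule: "length r < length l \<or> length r = length l \<and> fst ` set r = fst ` set l"
    if "(l, r) \<in> completed_system" for l r
    using that
  proof (cases rule: completed_system_cases)
    case (pull w x e)
    then show ?thesis by (auto simp: pull_def image_image)
  qed simp
  have trans: "a < b \<or> a = b \<and> X = Y \<Longrightarrow> b < c \<or> b = c \<and> Y = Z \<Longrightarrow> a < c \<or> a = c \<and> X = Z"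
    for a b c :: nat and X Y Z :: "'a set" by auto
  have "v \<in> lists S \<and> (length v < length u \<or> length v = length u \<and> fst ` set v = fst ` set u)"
    using assms(1)
  proof (induction rule: rtrancl_induct)
    case base
    with assms show ?case by simp
  next
    case (step v w)
    then obtain p l r q where vw: "v = p @ l @ q" "w = p @ r @ q" and lr: "(l, r) \<in> completed_system"
      using assms(2) by (auto simp: rstep_def)
    have "w \<in> lists S"
      using completed_system_letters[OF lr] step.IH vw by simp
    moreover have "length w < length v \<or> length w = length v \<and> fst ` set w = fst ` set v"
      using rule[OF lr] by (auto simp: vw image_Un)
    from trans[OF this conjunct2[OF step.IH]]
    have "length w < length u \<or> length w = length u \<and> fst ` set w = fst ` set u" .
    ultimately show ?case ..
  qed
  then show "v \<in> lists S"
    and "length v < length u \<or> length v = length u \<and> fst ` set v = fst ` set u" by auto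
qed

lemma rsteps_length:
  "(u, v) \<in> (rstep S R)\<^sup>* \<Longrightarrow> R \<subseteq> completed_system \<Longrightarrow> u \<in> lists S \<Longrightarrow> length v \<le> length u"
  using rsteps_words(2) by fastforce

lemma normal_form_exists:
  assumes "R \<subseteq> completed_system"
  shows "\<exists>a. normal_form_of S R w a"
proof -
  have "wf ((rstep S R)\<inverse>)"
    by (rule wf_subset[OF wf_rstep]) (use rstep_mono[OF assms, of S] in blast)
  then show ?thesis
  proof (induction w rule: wf_induct_rule)
    case (less w)
    show ?case
    proof (cases "irreducible_word S R w")
      case True
      then show ?thesis by (auto simp: normal_form_of_def)
    next
      case False
      then obtain v where v: "(w, v) \<in> rstep S R" by (auto simp: irreducible_word_def)
      then have "\<exists>a. normal_form_of S R v a" by (intro less.IH) simp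
      then obtain a where "normal_form_of S R v a" ..
      then have "normal_form_of S R w a"
        using converse_rtrancl_into_rtrancl[OF v] by (simp add: normal_form_of_def)
      then show ?thesis ..
    qed
  qed
qed

lemma irreducible_completed:
  assumes "w \<in> lists S" "irreducible_word S completed_system w"
  shows "normal w"
proof (rule ccontr)
  assume "\<not> normal w"
  then obtain p l r q where w: "w = p @ l @ q" and "(l, r) \<in> completed_system"
    using non_normal_contains_lhs[OF assms(1)] by blast
  with assms(1) have "(w, p @ r @ q) \<in> rstep S completed_system"
    unfolding w by (intro rstepI) simp_all
  with assms(2) show False by (auto simp: irreducible_word_def)
qed

lemma confluent_completed: "confluent S completed_system"
  unfolding confluent_def
proof (intro ballI allI impI, elim conjE)
  fix u w1 w2
  assume u: "u \<in> lists S" and w1: "(u, w1) \<in> (rstep S completed_system)\<^sup>*"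
    and w2: "(u, w2) \<in> (rstep S completed_system)\<^sup>*"
  obtain a1 a2 where a1: "normal_form_of S completed_system w1 a1"
      and a2: "normal_form_of S completed_system w2 a2"
    using normal_form_exists[OF subset_refl] by meson
  have ua1: "(u, a1) \<in> (rstep S completed_system)\<^sup>*" and ua2: "(u, a2) \<in> (rstep S completed_system)\<^sup>*"
    using a1 a2 rtrancl_trans[OF w1] rtrancl_trans[OF w2] by (simp_all add: normal_form_of_def)
  have "normal a1" "normal a2"
    using a1 a2 rsteps_words(1)[OF ua1 subset_refl u] rsteps_words(1)[OF ua2 subset_refl u]
      irreducible_completed
    by (simp_all add: normal_form_of_def)
  moreover have "(a1, a2) \<in> congruent_words"
    using congruent_trans[OF congruent_sym[OF rsteps_congruent[OF ua1 subset_refl]]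
        rsteps_congruent[OF ua2 subset_refl]] .
  ultimately have "a1 = a2" by (intro normal_unique)
  with a1 a2 have "(w1, a2) \<in> (rstep S completed_system)\<^sup>*" "(w2, a2) \<in> (rstep S completed_system)\<^sup>*"
    by (simp_all add: normal_form_of_def)
  then show "\<exists>w. (w1, w) \<in> (rstep S completed_system)\<^sup>* \<and> (w2, w) \<in> (rstep S completed_system)\<^sup>*"
    by blast
qed

lemma equivalent_completed: "equivalent_systems S completed_system (initial_system \<Gamma>)"
  unfolding equivalent_systems_def
proof
  have "rstep S completed_system \<subseteq> congruent_words"
    using rsteps_congruent[OF r_into_rtrancl subset_refl] by (intro subrelI)
  moreover from this have "(rstep S completed_system)\<inverse> \<subseteq> congruent_words"
    using congruent_sym by (intro subrelI) (drule converseD, drule (1) subsetD)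
  ultimately have "(rstep S completed_system \<union> (rstep S completed_system)\<inverse>)\<^sup>* \<subseteq> congruent_words\<^sup>*"
    by (intro rtrancl_mono) blast
  then show "(rstep S completed_system \<union> (rstep S completed_system)\<inverse>)\<^sup>* \<subseteq> congruent_words"
    by simp
  have "rstep S (initial_system \<Gamma>) \<subseteq> rstep S completed_system"
    using truncated_0 truncated_subset by (intro rstep_mono) blast
  then show "congruent_words \<subseteq> (rstep S completed_system \<union> (rstep S completed_system)\<inverse>)\<^sup>*"
    by (intro rtrancl_mono) blast
qed

section \<open>Critical pairs of the truncated systems\<close>

abbreviation new_rules :: "nat \<Rightarrow> 'a letter rule set" where
  "new_rules n \<equiv> truncated_system (Suc n) - truncated_system n"

lemma new_rule_completed: "(l, r) \<in> new_rules n \<Longrightarrow> (l, r) \<in> completed_system"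
  by (simp add: truncated_system_def)

lemma new_rule_rhs_normal: "(l, r) \<in> new_rules n \<Longrightarrow> normal r"
  by (erule long_rule) (simp add: normal_pull)

lemma length_new_rule: "(l, r) \<in> new_rules n \<Longrightarrow> length l = n + 3 \<and> length r = n + 3"
  by (erule long_rule) (simp add: pull_def)

text \<open>This settles all critical pairs from overlap words of length at most \<open>n + 3\<close>, for every shape of
  the overlap and every choice of normal forms. Two left sides are equal if they are congruent, because their right
  sides are normal and determine them.\<close>

lemma irreducible_congruent_words:
  assumes "(a, b) \<in> congruent_words"
    and a: "a \<in> lists S" "length a \<le> n + 3" "irreducible_word S (truncated_system n) a"
    and b: "b \<in> lists S" "length b \<le> n + 3" "irreducible_word S (truncated_system n) b"
  shows "a = b \<or> (a, b) \<in> new_rules n \<or> (b, a) \<in> new_rules n"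
proof -
  have eq: "(r, r') \<in> congruent_words \<Longrightarrow> normal r \<Longrightarrow> normal r' \<Longrightarrow> r = r'" for r r'
    by (rule normal_unique)
  consider "normal a" "normal b" | r where "(a, r) \<in> new_rules n" "normal b"
    | r where "(b, r) \<in> new_rules n" "normal a"
    | r r' where "(a, r) \<in> new_rules n" "(b, r') \<in> new_rules n"
    using irreducible_truncated[OF a] irreducible_truncated[OF b] by metis
  then show ?thesis
  proof cases
    case 1
    with eq assms(1) show ?thesis by blast
  next
    case (2 r)
    have "(r, b) \<in> congruent_words"
      using congruent_trans[OF congruent_sym[OF rule_congruent[OF new_rule_completed[OF 2(1)]]] assms(1)] .
    then have "r = b" using eq new_rule_rhs_normal[OF 2(1)] 2(2) by simp
    with 2(1) show ?thesis by simp
  next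
    case (3 r)
    have "(r, a) \<in> congruent_words"
      using congruent_trans[OF congruent_sym[OF rule_congruent[OF new_rule_completed[OF 3(1)]]]
          congruent_sym[OF assms(1)]] .
    then have "r = a" using eq new_rule_rhs_normal[OF 3(1)] 3(2) by simp
    with 3(1) show ?thesis by simp
  next
    case (4 r r')
    have "(r, b) \<in> congruent_words"
      using congruent_trans[OF congruent_sym[OF rule_congruent[OF new_rule_completed[OF 4(1)]]] assms(1)] .
    from congruent_trans[OF this rule_congruent[OF new_rule_completed[OF 4(2)]]]
    have "r = r'" using eq new_rule_rhs_normal[OF 4(1)] new_rule_rhs_normal[OF 4(2)] by simp
    from 4(1) obtain w x e where a: "a = w @ [(x, e)]" "r = pull w x e" by (rule long_rule)
    from 4(2) obtain w' x' e' where b: "b = w' @ [(x', e')]" "r' = pull w' x' e'" by (rule long_rule)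
    have "w = w' \<and> x = x' \<and> e = e'"
      using \<open>r = r'\<close> a b by (intro pull_inject) simp
    with a b show ?thesis by simp
  qed
qed

lemma overlap_words:
  assumes "ov \<in> overlaps R" "R \<subseteq> completed_system"
  shows "overlap_word ov \<in> lists S"
    and "(overlap_word ov, reduct_left ov) \<in> (rstep S R)\<^sup>*"
    and "(overlap_word ov, reduct_right ov) \<in> (rstep S R)\<^sup>*"
proof -
  obtain u s v r1 r2 where ov: "ov = Overlap (u @ s, r1) (s @ v, r2) u s v"
    and rules: "(u @ s, r1) \<in> R" "(s @ v, r2) \<in> R"
    using assms(1) by (rule overlapsE)
  have lists: "u \<in> lists S" "s \<in> lists S" "v \<in> lists S"
    using completed_system_letters(1)[OF subsetD[OF assms(2) rules(1)]]
      completed_system_letters(1)[OF subsetD[OF assms(2) rules(2)]] by simp_all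
  then show "overlap_word ov \<in> lists S" by (simp add: ov overlap_word_def)
  have "([] @ (u @ s) @ v, [] @ r1 @ v) \<in> rstep S R" "(u @ (s @ v) @ [], u @ r2 @ []) \<in> rstep S R"
    using rules lists by (intro rstepI; simp)+
  then show "(overlap_word ov, reduct_left ov) \<in> (rstep S R)\<^sup>*"
    and "(overlap_word ov, reduct_right ov) \<in> (rstep S R)\<^sup>*"
    by (auto simp: ov overlap_word_def reduct_left_def reduct_right_def)
qed

lemma critical_pair_normal_forms:
  assumes ov: "ov \<in> overlaps (truncated_system n)" "length (overlap_word ov) \<le> n + 3"
    and a: "normal_form_of S (truncated_system n) (reduct_left ov) a"
    and b: "normal_form_of S (truncated_system n) (reduct_right ov) b"
  shows "(overlap_word ov, a) \<in> (rstep S (truncated_system n))\<^sup>*"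
    and "(overlap_word ov, b) \<in> (rstep S (truncated_system n))\<^sup>*"
    and "length a \<le> length (overlap_word ov)" "length b \<le> length (overlap_word ov)"
    and "a = b \<or> (a, b) \<in> new_rules n \<or> (b, a) \<in> new_rules n"
proof -
  note word = overlap_words[OF ov(1) truncated_subset]
  show steps: "(overlap_word ov, a) \<in> (rstep S (truncated_system n))\<^sup>*"
    "(overlap_word ov, b) \<in> (rstep S (truncated_system n))\<^sup>*"
    using a b rtrancl_trans[OF word(2)] rtrancl_trans[OF word(3)] by (simp_all add: normal_form_of_def)
  show len: "length a \<le> length (overlap_word ov)" "length b \<le> length (overlap_word ov)"
    using rsteps_length[OF steps(1) truncated_subset word(1)]
      rsteps_length[OF steps(2) truncated_subset word(1)] .
  have "(a, b) \<in> congruent_words"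
    using congruent_trans[OF congruent_sym[OF rsteps_congruent[OF steps(1) truncated_subset]]
        rsteps_congruent[OF steps(2) truncated_subset]] .
  then show "a = b \<or> (a, b) \<in> new_rules n \<or> (b, a) \<in> new_rules n"
    using a b len ov(2) rsteps_words(1)[OF steps(1) truncated_subset word(1)]
      rsteps_words(1)[OF steps(2) truncated_subset word(1)]
    by (intro irreducible_congruent_words) (simp_all add: normal_form_of_def)
qed

lemma resolves_if_common_normal_form:
  "normal_form_of S R (reduct_left ov) a \<Longrightarrow> normal_form_of S R (reduct_right ov) a \<Longrightarrow> resolves S R ov"
  by (auto simp: resolves_def normal_form_of_def)

lemma short_overlap_resolves:
  assumes ov: "ov \<in> overlaps (truncated_system n)" and len: "length (overlap_word ov) \<le> n + 2"
  shows "resolves S (truncated_system n) ov"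
proof -
  obtain a where a: "normal_form_of S (truncated_system n) (reduct_left ov) a"
    using normal_form_exists[OF truncated_subset] by meson
  obtain b where b: "normal_form_of S (truncated_system n) (reduct_right ov) b"
    using normal_form_exists[OF truncated_subset] by meson
  have "length (overlap_word ov) \<le> n + 3" using len by simp
  note nf = critical_pair_normal_forms[OF ov this a b]
  have "a = b"
    using nf(3,4,5) len length_new_rule[of a b n] length_new_rule[of b a n] by auto
  with a b show ?thesis using resolves_if_common_normal_form by blast
qed

lemma completed_overlap_resolves:
  assumes "ov \<in> overlaps completed_system"
  shows "resolves S completed_system ov"
  using overlap_words[OF assms subset_refl] confluent_completed
  unfolding confluent_def resolves_def by blast

lemma pullable_take:
  assumes "pullable w x" "0 < k"
  shows "pullable (take k w) x"
proof -
  have "normal (take k w)"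
    using normal_append[of "[]" "take k w" "drop k w"] assms(1) by (simp add: pullable_def)
  moreover have "hd (take k w) = hd w" "take k w \<noteq> []"
    using assms by (auto simp: pullable_def)
  moreover have "\<forall>l\<in>set (take k w). adjacent \<Gamma> (fst l) x" "\<forall>l\<in>set (tl (take k w)). fst l < x"
    using assms(1) by (auto simp: pullable_def tl_take dest: in_set_takeD)
  ultimately show ?thesis
    using assms(1) by (simp add: pullable_def)
qed

lemma completed_ruleI: "pullable w x \<Longrightarrow> (w @ [(x, e)], pull w x e) \<in> completed_system"
  unfolding completed_system_def by blast

text \<open>If \<open>w x\<close> is a left side, then so is \<open>w' x\<close> for every non-empty prefix \<open>w'\<close> of \<open>w\<close>. Hence a longer
  rule would give one of length \<open>n + 3\<close>.\<close>

lemma truncated_stable: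
  assumes "new_rules n = {}"
  shows "truncated_system n = completed_system"
proof (rule ccontr)
  assume "truncated_system n \<noteq> completed_system"
  with truncated_subset obtain l r where lr: "(l, r) \<in> completed_system" and len: "n + 2 < length l"
    by (fastforce simp: truncated_system_def)
  from lr show False
  proof (cases rule: completed_system_cases)
    case (vertex z \<gamma>)
    with len show False by simp
  next
    case (pull w x e)
    then have "length (take (n + 2) w) = n + 2" using len by simp
    moreover have "(take (n + 2) w @ [(x, e)], pull (take (n + 2) w) x e) \<in> completed_system"
      using pull(1) by (intro completed_ruleI pullable_take) simp_all
    ultimately have "(take (n + 2) w @ [(x, e)], pull (take (n + 2) w) x e) \<in> new_rules n"
      by (simp add: truncated_system_def)
    with assms show False by blast
  qed
qed

text \<open>A shorter left side inside \<open>w x\<close> would be a proper suffix as \<open>w\<close> is normal. It does not belong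
  to a vertex rule because \<open>x\<close> is adjacent to all vertices of \<open>w\<close>. The first letter of any other left
  side is larger than \<open>x\<close>, whereas the letters of \<open>w\<close> after the first are smaller.\<close>

lemma lhs_irreducible:
  assumes "(l, r) \<in> new_rules n"
  shows "irreducible_word S (truncated_system n) l"
  unfolding irreducible_word_def
proof (intro notI, elim exE)
  fix l'
  assume "(l, l') \<in> rstep S (truncated_system n)"
  then obtain p k k' q where l: "l = p @ k @ q" and k: "(k, k') \<in> truncated_system n"
    by (auto simp: rstep_def)
  obtain w x e where w: "pullable w x" "l = w @ [(x, e)]" "length w = n + 2"
    using assms by (rule long_rule)
  have k_rule: "(k, k') \<in> completed_system" and "length k \<le> n + 2"
    using k by (auto simp: truncated_system_def)
  then have nn: "\<not> normal k" using lhs_not_normal by blast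
  show False
  proof (cases q rule: rev_cases)
    case (snoc q' c)
    with l w have "w = p @ k @ q'" by simp
    with nn w(1) normal_append show False by (auto simp: pullable_def)
  next
    case Nil
    with l w have eq: "w @ [(x, e)] = p @ k" by simp
    from arg_cong[OF this, of length] have "p \<noteq> []"
      using \<open>length k \<le> n + 2\<close> w(3) by auto
    have adj: "\<forall>l\<in>set w. adjacent \<Gamma> (fst l) x" using w(1) by (simp add: pullable_def)
    from k_rule show False
    proof (cases rule: completed_system_cases)
      case (vertex z \<gamma>)
      with eq have "w = p @ [(z, \<gamma>)]" "z = x" by auto
      with adj adj_irrefl show False by auto
    next
      case (pull v y e')
      with eq have v: "w = p @ v" "y = x" by auto
      with pull have "v \<noteq> []" "x < fst (hd v)" by (auto simp: pullable_def)
      moreover have "hd v \<in> set (tl w)"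
        using v \<open>p \<noteq> []\<close> \<open>v \<noteq> []\<close> by simp
      ultimately show False using w(1) by (fastforce simp: pullable_def)
    qed
  qed
qed

text \<open>For \<open>l = g\<^sub>1 \<dots> g\<^sub>k x\<close> the rule for \<open>g\<^sub>1 \<dots> g\<^sub>k\<^sub>-\<^sub>1 x\<close> overlaps with the edge rule that exchanges
  \<open>x\<close> and \<open>g\<^sub>k\<close>. Reducing the overlap word \<open>g\<^sub>1 \<dots> g\<^sub>k\<^sub>-\<^sub>1 x g\<^sub>k\<close> by either rule gives exactly the two
  sides of the new rule.\<close>

lemma new_rule_from_overlap:
  assumes "(l, r) \<in> new_rules n"
  obtains ov where "ov \<in> overlaps (truncated_system n)" "reduct_left ov = r" "reduct_right ov = l"
    "length (overlap_word ov) = n + 3"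
proof -
  obtain w x e where w: "pullable w x" and l: "l = w @ [(x, e)]" and r: "r = pull w x e"
    and len: "length w = n + 2"
    using assms by (rule long_rule)
  obtain v g j where v: "w = v @ [(g, j)]" "length v = n + 1"
    using len by (cases w rule: rev_cases) auto
  have "(g, j) \<in> set (tl w)" using v by (cases v) auto
  with w have g: "g < x" "adjacent \<Gamma> g x"
    using list.set_sel(2) unfolding pullable_def by fastforce+
  \<comment> \<open>The signs of \<open>x\<close> and \<open>g\<close> in the overlap word are those that the edge rule turns into \<open>e\<close>
    and \<open>j\<close>.\<close>
  define e1 where "e1 = (e \<noteq> directed \<Gamma> x g)"
  define j1 where "j1 = (j \<noteq> directed \<Gamma> g x)"
  have "pullable v x" using pullable_take[OF w, of "n + 1"] v by simp
  then have left: "(v @ [(x, e1)], pull v x e1) \<in> truncated_system n"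
    using completed_ruleI[of v x e1] v(2) by (simp add: truncated_system_def)
  have "([(x, e1), (g, j1)], [(g, j), (x, e)]) \<in> initial_system \<Gamma>"
    using edge_rule[OF g, of e1 j1] by (cases "directed \<Gamma> x g"; cases "directed \<Gamma> g x") (simp_all add: e1_def j1_def)
  then have right: "([(x, e1)] @ [(g, j1)], [(g, j), (x, e)]) \<in> truncated_system n"
    using truncated_mono[of 0 n] by (auto simp: truncated_0)
  define ov where "ov = Overlap (v @ [(x, e1)], pull v x e1) ([(x, e1)] @ [(g, j1)], [(g, j), (x, e)])
    v [(x, e1)] [(g, j1)]"
  have "ov \<in> overlaps (truncated_system n)"
    using left right unfolding overlaps_def ov_def by blast
  moreover have "reduct_left ov = r"
    by (auto simp: ov_def reduct_left_def r v pull_def flip_by_def e1_def j1_def)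
  moreover have "reduct_right ov = l"
    by (simp add: ov_def reduct_right_def l v)
  moreover have "length (overlap_word ov) = n + 3"
    by (simp add: ov_def overlap_word_def v)
  ultimately show thesis by (rule that)
qed

section \<open>The steps of the completion\<close>

lemma irreducible_rsteps: "irreducible_word X R a \<Longrightarrow> (a, w) \<in> (rstep X R)\<^sup>* \<Longrightarrow> w = a"
  by (erule converse_rtranclE) (auto simp: irreducible_word_def)

lemma rhs_irreducible: "(l, r) \<in> new_rules n \<Longrightarrow> irreducible_word S (truncated_system n) r"
  by (rule normal_irreducible[OF new_rule_rhs_normal truncated_subset])

lemma rule_sides_differ: "(l, r) \<in> completed_system \<Longrightarrow> l \<noteq> r"
  using rule_shortlex shortlex_asym by blast

lemma length_unresolved:
  assumes "ov \<in> unresolved S (truncated_system n)"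
  shows "n + 3 \<le> length (overlap_word ov)"
  using assms short_overlap_resolves[of ov n] by (fastforce simp: unresolved_def)

lemma new_rule_from_unresolved:
  assumes "(l, r) \<in> new_rules n"
  obtains ov where "ov \<in> unresolved S (truncated_system n)" "length (overlap_word ov) = n + 3"
    "reduct_left ov = r" "reduct_right ov = l"
proof -
  obtain ov where ov: "ov \<in> overlaps (truncated_system n)" "reduct_left ov = r" "reduct_right ov = l"
    "length (overlap_word ov) = n + 3"
    using new_rule_from_overlap[OF assms] .
  have "\<not> resolves S (truncated_system n) ov"
  proof
    assume "resolves S (truncated_system n) ov"
    then obtain w where "(r, w) \<in> (rstep S (truncated_system n))\<^sup>*" "(l, w) \<in> (rstep S (truncated_system n))\<^sup>*"
      using ov by (auto simp: resolves_def)
    then have "w = r" "w = l"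
      using irreducible_rsteps[OF rhs_irreducible[OF assms]] irreducible_rsteps[OF lhs_irreducible[OF assms]]
      by simp_all
    then show False using rule_sides_differ[OF new_rule_completed[OF assms]] by simp
  qed
  with ov show thesis by (intro that) (simp_all add: unresolved_def)
qed

text \<open>An unresolved overlap shows that the system is not yet complete. Then a rule of length \<open>n + 3\<close>
  is still missing, and it comes from an unresolved overlap of that length, which is the least
  possible one.\<close>

lemma length_treated:
  assumes "ov \<in> treated S (truncated_system n)"
  shows "length (overlap_word ov) = n + 3"
proof -
  have unres: "ov \<in> unresolved S (truncated_system n)"
    using assms by (simp add: treated_def)
  have "new_rules n \<noteq> {}"
  proof
    assume "new_rules n = {}"
    then have "truncated_system n = completed_system" by (rule truncated_stable)
    with unres completed_overlap_resolves[of ov] show False by (simp add: unresolved_def)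
  qed
  then obtain l r where "(l, r) \<in> new_rules n" by auto
  then obtain ov' where "ov' \<in> unresolved S (truncated_system n)" "length (overlap_word ov') = n + 3"
    by (rule new_rule_from_unresolved)
  with assms have "length (overlap_word ov) \<le> n + 3" unfolding treated_def by fastforce
  with length_unresolved[OF unres] show ?thesis by simp
qed

lemma treated_critical_pair:
  assumes "ov \<in> treated S (truncated_system n)"
    and a: "normal_form_of S (truncated_system n) (reduct_left ov) a"
    and b: "normal_form_of S (truncated_system n) (reduct_right ov) b"
  shows "(a, b) \<in> new_rules n \<or> (b, a) \<in> new_rules n"
proof -
  have ov: "ov \<in> overlaps (truncated_system n)" "\<not> resolves S (truncated_system n) ov"
    using assms(1) by (auto simp: treated_def unresolved_def)
  then have "a \<noteq> b" using a b resolves_if_common_normal_form by blast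
  moreover have "length (overlap_word ov) \<le> n + 3" using length_treated[OF assms(1)] by simp
  ultimately show ?thesis using critical_pair_normal_forms(5)[OF ov(1) _ a b] by blast
qed

lemma created_rule_new:
  assumes "ov \<in> treated S (truncated_system n)"
    "created_rule S shortlex (truncated_system n) ov \<rho>"
  shows "\<rho> \<in> new_rules n"
proof -
  obtain a b where nf: "normal_form_of S (truncated_system n) (reduct_left ov) a"
      "normal_form_of S (truncated_system n) (reduct_right ov) b"
    and \<rho>: "\<rho> = (a, b) \<and> (b, a) \<in> shortlex \<or> \<rho> = (b, a) \<and> (a, b) \<in> shortlex"
    using assms(2) by (auto simp: created_rule_def)
  have "(a, b) \<in> new_rules n \<or> (b, a) \<in> new_rules n"
    using treated_critical_pair[OF assms(1) nf] .
  then show ?thesis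
    using \<rho> rule_shortlex[OF new_rule_completed] shortlex_asym by blast
qed

lemma created_rule_exists:
  assumes "ov \<in> treated S (truncated_system n)"
  shows "\<exists>\<rho>. created_rule S shortlex (truncated_system n) ov \<rho>"
proof -
  obtain a where a: "normal_form_of S (truncated_system n) (reduct_left ov) a"
    using normal_form_exists[OF truncated_subset] by meson
  obtain b where b: "normal_form_of S (truncated_system n) (reduct_right ov) b"
    using normal_form_exists[OF truncated_subset] by meson
  have "(b, a) \<in> shortlex \<or> (a, b) \<in> shortlex"
    using treated_critical_pair[OF assms a b] rule_shortlex[OF new_rule_completed] by blast
  with a b show ?thesis unfolding created_rule_def by blast
qed

lemma new_rule_created:
  assumes "\<rho> \<in> new_rules n"
  shows "\<exists>ov\<in>treated S (truncated_system n).
    \<forall>\<rho>'. created_rule S shortlex (truncated_system n) ov \<rho>' \<longrightarrow> \<rho>' = \<rho>"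
proof -
  obtain l r where \<rho>: "\<rho> = (l, r)" by (cases \<rho>)
  with assms have lr: "(l, r) \<in> new_rules n" by simp
  then obtain ov where ov: "ov \<in> unresolved S (truncated_system n)" "length (overlap_word ov) = n + 3"
    "reduct_left ov = r" "reduct_right ov = l"
    by (rule new_rule_from_unresolved)
  have treated: "ov \<in> treated S (truncated_system n)"
    using ov(1,2) length_unresolved by (simp add: treated_def)
  moreover have "\<rho>' = \<rho>" if created: "created_rule S shortlex (truncated_system n) ov \<rho>'" for \<rho>'
  proof -
    obtain a b where nf: "(r, a) \<in> (rstep S (truncated_system n))\<^sup>*" "(l, b) \<in> (rstep S (truncated_system n))\<^sup>*"
      and \<rho>': "\<rho>' = (a, b) \<and> (b, a) \<in> shortlex \<or> \<rho>' = (b, a) \<and> (a, b) \<in> shortlex"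
      using created ov(3,4) by (auto simp: created_rule_def normal_form_of_def)
    have "a = r" "b = l"
      using irreducible_rsteps[OF rhs_irreducible[OF lr] nf(1)]
        irreducible_rsteps[OF lhs_irreducible[OF lr] nf(2)] by simp_all
    with \<rho>' show ?thesis
      using rule_shortlex[OF new_rule_completed[OF lr]] shortlex_asym \<rho> by blast
  qed
  ultimately show ?thesis by blast
qed

lemma kb_step_truncated_iff:
  "kb_step S shortlex (truncated_system n) R \<longleftrightarrow> R = truncated_system (Suc n)"
proof -
  have image: "truncated_system n \<union> c ` treated S (truncated_system n) = truncated_system (Suc n)"
    if c: "\<forall>ov\<in>treated S (truncated_system n). created_rule S shortlex (truncated_system n) ov (c ov)" for c
  proof -
    have "c ` treated S (truncated_system n) = new_rules n"
    proof
      show "c ` treated S (truncated_system n) \<subseteq> new_rules n"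
        using c created_rule_new by blast
      show "new_rules n \<subseteq> c ` treated S (truncated_system n)"
      proof
        fix \<rho> assume "\<rho> \<in> new_rules n"
        with c new_rule_created[of \<rho> n] show "\<rho> \<in> c ` treated S (truncated_system n)" by blast
      qed
    qed
    with truncated_mono[of n "Suc n"] show ?thesis by auto
  qed
  have "\<exists>c. \<forall>ov\<in>treated S (truncated_system n). created_rule S shortlex (truncated_system n) ov (c ov)"
    using created_rule_exists by (intro bchoice ballI)
  with image show ?thesis unfolding kb_step_def by metis
qed

lemma kb_completion_iff:
  "kb_completion S shortlex (initial_system \<Gamma>) Rs \<longleftrightarrow> Rs = truncated_system"
proof
  assume kb: "kb_completion S shortlex (initial_system \<Gamma>) Rs"
  have "Rs n = truncated_system n" for n
  proof (induction n)
    case 0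
    with kb show ?case by (simp add: kb_completion_def truncated_0)
  next
    case (Suc n)
    with kb kb_step_truncated_iff show ?case by (metis kb_completion_def)
  qed
  then show "Rs = truncated_system" by blast
next
  assume "Rs = truncated_system"
  then show "kb_completion S shortlex (initial_system \<Gamma>) Rs"
    using kb_step_truncated_iff by (simp add: kb_completion_def truncated_0)
qed

text \<open>The vertices of a left side determine \<open>x\<close>: it is the second largest of them.\<close>

lemma pullable_vertices:
  assumes "pullable w x" "M = insert x (fst ` set w)"
  shows "fst (hd w) \<in> M" "x \<in> M" "x < fst (hd w)" "\<And>m. m \<in> M \<Longrightarrow> m = fst (hd w) \<or> m \<le> x"
proof -
  obtain a w' where w: "w = a # w'" using assms(1) by (cases w) (auto simp: pullable_def)
  show "fst (hd w) \<in> M" "x \<in> M" "x < fst (hd w)"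
    using assms w by (auto simp: pullable_def)
  show "m = fst (hd w) \<or> m \<le> x" if "m \<in> M" for m
    using assms that w by (auto simp: pullable_def less_imp_le)
qed

text \<open>Let the overlap of two rules be treated, with a right-hand rule for \<open>h\<^sub>1 \<dots> h\<^sub>m z\<close>, \<open>m \<ge> 2\<close>. The
  left-hand rule is not a vertex rule, because then two letters would be lost, whereas a new rule
  is as long as the overlap word. So it is a rule for some \<open>g\<^sub>1 \<dots> g\<^sub>k x\<close>. If the shared part has more
  than one letter, the conditions on the two rules contradict each other or the rules are the same.
  Otherwise \<open>x = h\<^sub>1\<close>, and \<open>x\<close> is the second largest vertex of the overlap word. This word reduces to
  the left side \<open>w\<^sub>0 y\<close> of a new rule, which is equally long and so has the same vertices. Hence
  \<open>x = y\<close> is adjacent to all other vertices, in particular to \<open>h\<^sub>2 < h\<^sub>1\<close>, contrary to the normality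
  of \<open>h\<^sub>1 \<dots> h\<^sub>m\<close>.\<close>

lemma treated_right_rule_initial:
  assumes "ov \<in> treated S (truncated_system n)"
  shows "right_rule ov \<in> initial_system \<Gamma>"
proof (rule ccontr)
  assume not_initial: "right_rule ov \<notin> initial_system \<Gamma>"
  have in_overlaps: "ov \<in> overlaps (truncated_system n)" and unres: "\<not> resolves S (truncated_system n) ov"
    using assms by (auto simp: treated_def unresolved_def)
  obtain u s v r1 r2 where ov: "ov = Overlap (u @ s, r1) (s @ v, r2) u s v" and "s \<noteq> []"
    and "(u @ s, r1) \<in> truncated_system n" "(s @ v, r2) \<in> truncated_system n"
    using in_overlaps by (rule overlapsE)
  then have left: "(u @ s, r1) \<in> completed_system" and right: "(s @ v, r2) \<in> completed_system"
    using truncated_subset by auto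
  have len: "length (overlap_word ov) = n + 3" by (rule length_treated[OF assms])
  obtain a where a: "normal_form_of S (truncated_system n) (reduct_left ov) a"
    using normal_form_exists[OF truncated_subset] by meson
  obtain b where b: "normal_form_of S (truncated_system n) (reduct_right ov) b"
    using normal_form_exists[OF truncated_subset] by meson
  have new: "(a, b) \<in> new_rules n \<or> (b, a) \<in> new_rules n"
    by (rule treated_critical_pair[OF assms a b])
  note nf = critical_pair_normal_forms[OF in_overlaps eq_refl[OF len] a b]
  have len_ab: "length a = n + 3" "length b = n + 3"
    using new length_new_rule by blast+
  note word = overlap_words[OF in_overlaps truncated_subset]

  from left show False
  proof (cases rule: completed_system_cases)
    case (vertex z \<gamma>)
    have "length a \<le> length (reduct_left ov)"
      using a rsteps_length[OF _ truncated_subset rsteps_words(1)[OF word(2) truncated_subset word(1)], of a n]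
      by (simp add: normal_form_of_def)
    moreover have "length (reduct_left ov) + 2 = length (overlap_word ov)"
      using arg_cong[OF vertex(2), of length] vertex(3) by (simp add: ov reduct_left_def overlap_word_def)
    ultimately show False using len_ab len by simp
  next
    case left_pull: (pull w1 x e1)
    from right show False
    proof (cases rule: completed_system_cases)
      case (vertex z \<gamma>)
      then show False
        using not_initial by (auto simp: ov initial_system_def vertex_rules_def)
    next
      case right_pull: (pull w2 z e2)
      have "length w2 \<noteq> 1"
      proof
        assume "length w2 = 1"
        with right right_pull have "(s @ v, r2) \<in> truncated_system 0"
          by (simp add: truncated_system_def)
        with not_initial show False by (simp add: ov truncated_0)
      qed
      obtain s' where s: "s = s' @ [(x, e1)]" and w1: "w1 = u @ s'"
        using left_pull(2) \<open>s \<noteq> []\<close> by (cases s rule: rev_cases) auto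
      have hd2: "z < fst (hd w2)" and tl2: "\<forall>l\<in>set (tl w2). fst l < z" and "w2 \<noteq> []"
        and norm2: "normal w2"
        using right_pull(1) by (auto simp: pullable_def)
      have tl1: "\<forall>l\<in>set (tl w1). fst l < x" using left_pull(1) by (simp add: pullable_def)
      show False
      proof (cases v rule: rev_cases)
        case Nil
        then have same: "s' = w2" "x = z" "e1 = e2"
          using right_pull(2) s by auto
        show False
        proof (cases u)
          case Nil
          then have "reduct_left ov = reduct_right ov"
            using \<open>v = []\<close> left_pull right_pull same w1 by (simp add: ov reduct_left_def reduct_right_def)
          with unres show False by (auto simp: resolves_def)
        next
          case (Cons c u')
          then have "hd w2 \<in> set (tl w1)" using w1 same \<open>w2 \<noteq> []\<close> by simp
          with tl1 hd2 same show False by fastforce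
        qed
      next
        case (snoc v' c)
        then have w2: "w2 = s' @ (x, e1) # v'" and v: "v = v' @ [(z, e2)]"
          using right_pull(2) s by auto
        show False
        proof (cases s')
          case (Cons d s'')
          show False
          proof (cases u)
            case Nil
            then have "w2 = [] @ (w1 @ [(x, e1)]) @ v'" using w1 w2 by simp
            then have "normal (w1 @ [(x, e1)])" using norm2 normal_append by metis
            with movable_pull[OF left_pull(1)] show False by (simp add: normal_def)
          next
            case (Cons c u')
            then have "d \<in> set (tl w1)" using w1 \<open>s' = d # s''\<close> by simp
            then have "fst d < x" using tl1 by blast
            moreover have "x < z" using tl2 w2 \<open>s' = d # s''\<close> by simp
            moreover have "z < fst d" using hd2 w2 \<open>s' = d # s''\<close> by simp
            ultimately show False by simp
          qed
        next
          case Nil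
          then have w2: "w2 = (x, e1) # v'" and w1: "w1 = u" using w1 w2 by simp_all
          with \<open>length w2 \<noteq> 1\<close> obtain c v'' where v': "v' = c # v''" by (cases v') auto
          have "z < x" and c: "fst c < z" using hd2 tl2 w2 v' by simp_all
          define M where "M = fst ` set (overlap_word ov)"
          have word_eq: "overlap_word ov = w1 @ (x, e1) # v' @ [(z, e2)]"
            by (simp add: ov overlap_word_def s v w1 Nil)
          obtain l r where lr: "(l, r) \<in> new_rules n" and l: "l = a \<or> l = b"
            using new by blast
          then obtain w0 y e0 where w0: "pullable w0 y" "l = w0 @ [(y, e0)]"
            by (meson long_rule)
          have "fst ` set l = M"
            using l rsteps_words(2)[OF nf(1) truncated_subset word(1)]
              rsteps_words(2)[OF nf(2) truncated_subset word(1)] len len_ab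
            by (auto simp: M_def)
          then have M: "M = insert y (fst ` set w0)" by (auto simp: w0(2))
          note pulled = pullable_vertices[OF w0(1) M]
          \<comment> \<open>The two largest vertices of the overlap word are those of \<open>hd w1\<close> and \<open>x\<close>; computed from \<open>l\<close>,
            they are those of \<open>hd w0\<close> and \<open>y\<close>.\<close>
          have A: "fst (hd w1) \<in> M" "x \<in> M" "x < fst (hd w1)"
            using left_pull(1) by (auto simp: M_def word_eq pullable_def)
          have "\<forall>l\<in>set v'. fst l < x"
            using tl2 w2 \<open>z < x\<close> by fastforce
          then have B: "m = fst (hd w1) \<or> m \<le> x" if "m \<in> M" for m
            using that pullable_vertices(4)[OF left_pull(1) refl, of m] \<open>z < x\<close>
            by (auto simp: M_def word_eq less_imp_le)
          have "fst (hd w1) = fst (hd w0)"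
            using pulled A B[of "fst (hd w0)"] by force
          then have "y = x"
            using pulled(2,3) pulled(4)[of x] A B[of y] by force
          have "fst c \<in> M" by (simp add: M_def word_eq v')
          then have "adjacent \<Gamma> (fst c) x"
            using M \<open>y = x\<close> c \<open>z < x\<close> w0(1) by (auto simp: pullable_def)
          then have "adjacent \<Gamma> x (fst c)" by (rule adj_sym)
          moreover have "map fst w2 = [] @ x # [] @ fst c # map fst v''" by (simp add: w2 v')
          moreover have "fst c < x" using c \<open>z < x\<close> by simp
          ultimately have "movable (map fst w2)" unfolding movable_def by fastforce
          with norm2 show False by (simp add: normal_def)
        qed
      qed
    qed
  qed
qed

lemma free_reduced_if_irreducible:
  assumes "w \<in> lists S" "irreducible_word S (vertex_rules \<Gamma>) w"
  shows "free_reduced w"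
  unfolding free_reduced_def
proof (intro notI, elim exE)
  fix p c q
  assume w: "w = p @ c # inv_letter c # q"
  with assms(1) have "([(fst c, snd c), (fst c, \<not> snd c)], []) \<in> vertex_rules \<Gamma>"
    by (auto simp: vertex_rules_def letters_def)
  from rstepI[OF this, of p S q] assms(1) w
  have "(w, p @ q) \<in> rstep S (vertex_rules \<Gamma>)" by (simp add: inv_letter_def)
  with assms(2) show False by (auto simp: irreducible_word_def)
qed

text \<open>The conditions on \<open>w\<close> depend on the signs only through free reducedness. Therefore all the sign
  variants with a freely reduced left side are rules as well.\<close>

lemma completed_rule_shape:
  assumes "\<rho> \<in> completed_system - vertex_rules \<Gamma>"
  shows "\<exists>gs x. gs \<noteq> [] \<and> set gs \<subseteq> verts \<Gamma> \<and> x \<in> verts \<Gamma> \<and> (\<forall>g\<in>set gs. adjacent \<Gamma> g x) \<and>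
           \<rho> \<in> commutation_rules \<Gamma> gs x \<and>
           (\<forall>\<sigma>\<in>commutation_rules \<Gamma> gs x.
              irreducible_word S (vertex_rules \<Gamma>) (fst \<sigma>) \<longrightarrow> \<sigma> \<in> completed_system) \<and>
           prefix_condition \<Gamma> gs x"
proof -
  obtain w x e where w: "pullable w x" and \<rho>: "\<rho> = (w @ [(x, e)], pull w x e)"
    using assms unfolding completed_system_def by blast
  have signs: "\<sigma> \<in> completed_system"
    if \<sigma>: "\<sigma> \<in> commutation_rules \<Gamma> (map fst w) x" and irr: "irreducible_word S (vertex_rules \<Gamma>) (fst \<sigma>)" for \<sigma>
  proof -
    obtain w' e' where w': "map fst w' = map fst w" and eq: "\<sigma> = (w' @ [(x, e')], pull w' x e')"
      using \<sigma> unfolding commutation_rules_eq by blast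
    have "w' @ [(x, e')] \<in> lists S"
    proof -
      have "fst ` set w' \<subseteq> verts \<Gamma>"
        using pullable_letters(3)[OF w] arg_cong[OF w', of set] by simp
      then show ?thesis using pullable_letters(2)[OF w] by (auto simp: letters_def)
    qed
    with irr have "free_reduced (w' @ [(x, e')])"
      by (intro free_reduced_if_irreducible) (simp_all add: eq)
    then have "free_reduced w'" using free_reduced_append[of "[]" w'] by simp
    moreover have "w' \<noteq> []" "fst (hd w') = fst (hd w)" "fst ` set w' = fst ` set w"
        "fst ` set (tl w') = fst ` set (tl w)"
    proof -
      show ne: "w' \<noteq> []" using w w' by (auto simp: pullable_def)
      moreover have "w \<noteq> []" using w by (simp add: pullable_def)
      ultimately show "fst (hd w') = fst (hd w)" using w' by (metis hd_map)
      show "fst ` set w' = fst ` set w" using arg_cong[OF w', of set] by simp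
      show "fst ` set (tl w') = fst ` set (tl w)" using arg_cong[OF w', of "\<lambda>v. set (tl v)"]
        by (simp add: map_tl[symmetric])
    qed
    ultimately have "pullable w' x"
      using w w' unfolding pullable_def normal_def by (metis (no_types, lifting) image_iff)
    then show ?thesis using completed_ruleI eq by simp
  qed
  have prefix: "prefix_condition \<Gamma> (map fst w) x"
    unfolding prefix_condition_def
  proof (intro conjI ballI subsetI)
    have hd: "hd (map fst w) = fst (hd w)" using w by (simp add: pullable_def hd_map)
    fix \<sigma> assume "\<sigma> \<in> commutation_rules \<Gamma> [hd (map fst w)] x"
    then obtain l j where "fst l = fst (hd w)" "\<sigma> = ([l] @ [(x, j)], pull [l] x j)"
      unfolding commutation_rules_eq hd by (auto simp: map_eq_Cons_conv)
    moreover from this have "pullable [l] x"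
      using w by (intro pullable_singleton) (auto simp: pullable_def)
    ultimately have "\<sigma> \<in> truncated_system 0"
      using completed_ruleI[of "[l]" x j] by (simp add: truncated_system_def)
    then show "\<sigma> \<in> initial_system \<Gamma>" by (simp add: truncated_0)
  next
    fix g \<sigma> assume g: "g \<in> set (tl (map fst w))" and "\<sigma> \<in> commutation_rules \<Gamma> [x] g"
    then obtain l j where l: "fst l = x" "\<sigma> = ([l] @ [(g, j)], pull [l] g j)"
      unfolding commutation_rules_eq by (auto simp: map_eq_Cons_conv)
    have "g < x" "adjacent \<Gamma> g x"
      using w g by (cases w; auto simp: pullable_def)+
    then have "pullable [l] g"
      using l adj_sym by (intro pullable_singleton) auto
    with l have "\<sigma> \<in> truncated_system 0"
      using completed_ruleI[of "[l]" g j] by (simp add: truncated_system_def)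
    then show "\<sigma> \<in> initial_system \<Gamma>" by (simp add: truncated_0)
  qed
  have "map fst w \<noteq> []" "\<forall>g\<in>set (map fst w). adjacent \<Gamma> g x"
    using w by (auto simp: pullable_def)
  moreover have "\<rho> \<in> commutation_rules \<Gamma> (map fst w) x"
    unfolding \<rho> commutation_rules_eq by blast
  ultimately show ?thesis
    using pullable_letters[OF w] signs prefix by blast
qed

end

theorem lemma3p8:
  fixes \<Gamma> :: "'a::linorder mixed_graph"
  assumes "finite_mixed_graph \<Gamma>"
  shows "(\<exists>Rs. kb_completion (letters \<Gamma>) shortlex (initial_system \<Gamma>) Rs) \<and>
    (\<forall>Rs. kb_completion (letters \<Gamma>) shortlex (initial_system \<Gamma>) Rs \<longrightarrow>
      (let R = (\<Union>n. Rs n) in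
        equivalent_systems (letters \<Gamma>) R (initial_system \<Gamma>) \<and>
        complete_system (letters \<Gamma>) R \<and>
        (\<forall>\<rho>\<in>R - vertex_rules \<Gamma>. \<exists>gs x.
           gs \<noteq> [] \<and> set gs \<subseteq> verts \<Gamma> \<and> x \<in> verts \<Gamma> \<and> (\<forall>g\<in>set gs. adjacent \<Gamma> g x) \<and>
           \<rho> \<in> commutation_rules \<Gamma> gs x \<and>
           (\<forall>\<sigma>\<in>commutation_rules \<Gamma> gs x.
              irreducible_word (letters \<Gamma>) (vertex_rules \<Gamma>) (fst \<sigma>) \<longrightarrow> \<sigma> \<in> R) \<and>
           prefix_condition \<Gamma> gs x) \<and>
        (\<forall>n. \<forall>ov\<in>treated (letters \<Gamma>) (Rs n). right_rule ov \<in> initial_system \<Gamma>) \<and>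
        (\<forall>ov\<in>overlaps R. right_rule ov \<notin> initial_system \<Gamma> \<longrightarrow> resolves (letters \<Gamma>) R ov) \<and>
        (\<forall>n. \<forall>(l, r)\<in>Rs (Suc n) - Rs n. length l = Suc n + 2 \<and> length r = Suc n + 2)))"
proof -
  interpret twisted_graph \<Gamma> by unfold_locales (rule assms)
  have lengths: "\<forall>(l, r)\<in>new_rules n. length l = Suc n + 2 \<and> length r = Suc n + 2" for n
    using length_new_rule[of _ _ n] by fastforce
  show ?thesis
    unfolding kb_completion_iff Let_def
    using equivalent_completed noetherian_completed confluent_completed completed_rule_shape
      treated_right_rule_initial completed_overlap_resolves lengths
    by (simp add: complete_system_def Union_truncated)
qed

end
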